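(* Let $N\ge2$ be an integer and let $\tilde Y:=\{\frac{\pi}{N}(2j-1)\}_{j=1}^N\subset(0,2\pi)$. Then for every $N$-point set $Y=\{y_j\}_{j=1}^N$ with $0<y_1<\cdots<y_N<2\pi$ there is $\alpha_0>0$ such that $$\lambda_1(\alpha,Y)\le\lambda_1(\alpha,\tilde Y)$$ holds for all $\alpha\in\mathbb{R}$ with $|\alpha|<\alpha_0$, and the inequality is strict for all $\alpha$ with $0<|\alpha|<\alpha_0$ unless $Y$ and $\tilde Y$ are congruent. Here $\lambda_1(\alpha,Y)$ is the lowest eigenvalue of the operator $H_{\alpha,Y}$ describing $N$ point interactions of strength $\alpha$ located at the points of $Y$ on a loop of length $2\pi$.
   Context: Let $I=(0,2\pi)$. For $\alpha\in\mathbb{R}$ and $Y=\{y_j\}_{j=1}^N$ with $0<y_1<\cdots<y_N<2\pi$, the operator $H_{\alpha,Y}$, formally $-\frac{\mathrm{d}^2}{\mathrm{d}x^2}+\alpha\sum_{j=1}^N\delta(x-y_j)$ with periodic boundary conditions, is the unique self-adjoint operator in $L^2(I)$ associated with the quadratic form $$q_{\alpha,Y}(\psi)=\|\psi'\|^2+\alpha\sum_{j=1}^N|\psi(y_j)|^2$$ defined on the functions $\psi\in H^1(I)$ with $\psi(0+)=\psi(2\pi-)$. Equivalently, it acts as $-\psi''$ away from $Y$ on functions that are $H^2$ on each component of $I\setminus Y$ and satisfy $\psi(y_j+)=\psi(y_j-)=:\psi(y_j)$ and $\psi'(y_j+)-\psi'(y_j-)=\alpha\psi(y_j)$ for $j=1,\dots,N$,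 together with $\psi(2\pi-)=\psi(0+)$ and $\psi'(2\pi-)=\psi'(0+)$. Its spectrum is purely discrete; $\lambda_1(\alpha,Y)$ denotes its smallest eigenvalue. Two $N$-point sets are called congruent if, viewed as subsets of the loop $\mathbb{R}/2\pi\mathbb{Z}$ with its arc-length metric, one is mapped onto the other by an isometry of the loop. *)

theory Defs
  imports "HOL-Analysis.Analysis"
begin

definition I_int :: "real set" where
  "I_int = {0<..<2 * pi}"

text \<open>
  Elements of \<open>L\<^sup>2(I)\<close> are represented by functions; only their values on \<open>I\<close> matter, and
  every class has a Borel measurable representative.
\<close>

definition L2 :: "(real \<Rightarrow> complex) set" where
  "L2 = {f. set_borel_measurable lborel I_int f \<and>
            set_integrable lborel I_int (\<lambda>x. (cmod (f x))\<^sup>2)}"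

definition L2_inner :: "(real \<Rightarrow> complex) \<Rightarrow> (real \<Rightarrow> complex) \<Rightarrow> complex" where
  "L2_inner f g = (LINT x:I_int|lborel. cnj (f x) * g x)"

text \<open>
  \<open>has_weak_deriv \<psi> g\<close>: \<open>\<psi>\<close> is the continuous representative of an element of \<open>H\<^sup>1(I)\<close> with
  derivative \<open>g\<close>, i.e. \<open>\<psi>\<close> is absolutely continuous on \<open>I\<close> and \<open>\<psi>' = g \<in> L\<^sup>2(I)\<close>.
  Using this representative gives the point values \<open>\<psi>(y)\<close> and the limits at the end points of
  \<open>I\<close> their meaning.  The derivative is determined up to a null set, so the choice made in
  \<open>weak_deriv\<close> does not affect integrals.
\<close>

definition has_weak_deriv :: "(real \<Rightarrow> complex) \<Rightarrow> (real \<Rightarrow> complex) \<Rightarrow> bool" where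
  "has_weak_deriv \<psi> g \<longleftrightarrow> g \<in> L2 \<and>
     (\<forall>x\<in>I_int. \<forall>y\<in>I_int. x \<le> y \<longrightarrow> \<psi> y - \<psi> x = (LINT t:{x..y}|lborel. g t))"

definition H1 :: "(real \<Rightarrow> complex) set" where
  "H1 = {\<psi>. \<exists>g. has_weak_deriv \<psi> g}"

definition weak_deriv :: "(real \<Rightarrow> complex) \<Rightarrow> real \<Rightarrow> complex" where
  "weak_deriv \<psi> = (SOME g. has_weak_deriv \<psi> g)"

text \<open>The form domain: \<open>\<psi> \<in> H\<^sup>1(I)\<close> with \<open>\<psi>(0+) = \<psi>(2\<pi>-)\<close>.\<close>

definition form_dom :: "(real \<Rightarrow> complex) set" where
  "form_dom = {\<psi> \<in> H1. \<exists>l. (\<psi> \<longlongrightarrow> l) (at_right 0) \<and> (\<psi> \<longlongrightarrow> l) (at_left (2 * pi))}"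

text \<open>
  The sesquilinear form whose diagonal is
  \<open>q(\<psi>) = \<parallel>\<psi>'\<parallel>\<^sup>2 + \<alpha> (\<Sum>y\<in>Y. \<bar>\<psi>(y)\<bar>\<^sup>2)\<close>.
\<close>

definition q_form :: "real \<Rightarrow> real set \<Rightarrow> (real \<Rightarrow> complex) \<Rightarrow> (real \<Rightarrow> complex) \<Rightarrow> complex" where
  "q_form \<alpha> Y \<phi> \<psi> =
     L2_inner (weak_deriv \<phi>) (weak_deriv \<psi>) + of_real \<alpha> * (\<Sum>y\<in>Y. cnj (\<phi> y) * \<psi> y)"

text \<open>
  The graph of the self-adjoint operator associated with the closed form: \<open>\<psi>\<close> lies in the
  operator domain and is mapped to \<open>\<eta>\<close> iff \<open>\<psi>\<close> lies in the form domain, \<open>\<eta> \<in> L\<^sup>2(I)\<close>, and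
  \<open>q(\<phi>, \<psi>) = \<langle>\<phi>, \<eta>\<rangle>\<close> for all \<open>\<phi>\<close> in the form domain.
\<close>

definition H_op :: "real \<Rightarrow> real set \<Rightarrow> (real \<Rightarrow> complex) \<Rightarrow> (real \<Rightarrow> complex) \<Rightarrow> bool" where
  "H_op \<alpha> Y \<psi> \<eta> \<longleftrightarrow> \<psi> \<in> form_dom \<and> \<eta> \<in> L2 \<and> (\<forall>\<phi>\<in>form_dom. q_form \<alpha> Y \<phi> \<psi> = L2_inner \<phi> \<eta>)"

definition is_eigenvalue :: "real \<Rightarrow> real set \<Rightarrow> complex \<Rightarrow> bool" where
  "is_eigenvalue \<alpha> Y \<mu> \<longleftrightarrow>
     (\<exists>\<psi>. \<not> (AE x\<in>I_int in lborel. \<psi> x = 0) \<and> H_op \<alpha> Y \<psi> (\<lambda>x. \<mu> * \<psi> x))"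

text \<open>All eigenvalues are real by self-adjointness, so the smallest one is sought among the reals.\<close>

definition lambda1 :: "real \<Rightarrow> real set \<Rightarrow> real" where
  "lambda1 \<alpha> Y = (LEAST \<mu>. is_eigenvalue \<alpha> Y (of_real \<mu>))"

definition Y_tilde :: "nat \<Rightarrow> real set" where
  "Y_tilde N = (\<lambda>j::nat. pi / real N * (2 * real j - 1)) ` {1..N}"

text \<open>
  The loop \<open>\<real>/2\<pi>\<int>\<close> is represented by the fundamental domain \<open>[0, 2\<pi>)\<close>; \<open>loop_dist\<close> is the
  arc-length distance for points of this domain.
\<close>

definition loop :: "real set" where
  "loop = {0..<2 * pi}"

definition loop_dist :: "real \<Rightarrow> real \<Rightarrow> real" where
  "loop_dist x y = min \<bar>x - y\<bar> (2 * pi - \<bar>x - y\<bar>)"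

definition loop_isometry :: "(real \<Rightarrow> real) \<Rightarrow> bool" where
  "loop_isometry f \<longleftrightarrow> bij_betw f loop loop \<and>
     (\<forall>x\<in>loop. \<forall>y\<in>loop. loop_dist (f x) (f y) = loop_dist x y)"

definition congruent_sets :: "real set \<Rightarrow> real set \<Rightarrow> bool" where
  "congruent_sets Y Z \<longleftrightarrow> (\<exists>f. loop_isometry f \<and> f ` Y = Z)"

end

theory Submission
  imports Defs
begin

text \<open>
  A positive solution of the eigenvalue problem is a ground state (Picone's identity), so
  \<open>lambda1\<close> can be read off from positive piecewise solutions of \<open>- u'' = \<kappa> u\<close>.

  Minimising \<open>q(\<psi>) - \<kappa> \<parallel>\<psi>\<parallel>\<^sup>2\<close> over all \<open>\<psi>\<close> with prescribed values at the points of \<open>Y\<close> gives,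
  for \<open>\<bar>\<kappa>\<bar> \<le> 1/16\<close>, a quadratic form in these finitely many values. By compactness there is a least \<open>\<kappa>\<close>
  for which it is not positive definite, and its null vector yields a positive solution. Hence
  \<open>lambda1 \<alpha> Y \<le> \<kappa>\<close> as soon as the form is nonpositive at one vector, strictly if it is negative there.

  For \<open>\<kappa> = k\<^sup>2\<close> the form at the vector \<open>(1, \<dots>, 1)\<close> is \<open>\<alpha> N - 2 (\<Sum>j. k tan (k l\<^sub>j / 2))\<close>, where \<open>l\<^sub>j\<close> are the
  arc lengths between neighbouring points, and for equidistant points \<open>\<kappa>\<close> is the lowest eigenvalue if it
  solves \<open>\<alpha> = 2 k tan (k \<pi> / N)\<close>; for negative \<open>\<kappa>\<close> the tangent becomes a hyperbolic tangent. Convexity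
  of \<open>l \<mapsto> k tan (k l / 2)\<close> compares the two.
\<close>

section \<open>Primitives of integrable functions\<close>

text \<open>\<open>lambda1\<close> is a \<open>LEAST\<close> over eigenvalues, so it says nothing
  until a smallest eigenvalue is known to exist. Picone's identity supplies one without spectral
  theory: a positive solution certifies itself as ground state. For a general \<open>Y\<close> no
  explicit solution is at hand; passing to node values replaces compactness in the
  infinite-dimensional form domain by compactness of a set of finite vectors. Two bounds make this
  work. With \<bar>\<kappa>\<bar> \<le> 1/16 every angle sqrt \<kappa> * l with l \<le> 2 pi is at
  most pi/2, so \<kappa> lies below the Dirichlet spectrum of every arc and the reduced form is
  defined. Smallness of \<alpha> makes this form positive definite at \<kappa> = -1/16, so the least
  \<kappa> is not the left end of the window, and it also brings the eigenvalue for equidistant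
  points into the window. The convexity has the same direction for both signs of \<kappa>, so
  attraction and repulsion are treated together.\<close>

definition prim :: "(real \<Rightarrow> complex) \<Rightarrow> real \<Rightarrow> complex" where
  "prim f x = (LINT t:{..x}|lborel. f t)"

lemma set_integrable_UNIV_subset:
  fixes f :: "real \<Rightarrow> complex"
  assumes "integrable lborel f" "A \<in> sets borel"
  shows "set_integrable lborel A f"
  using integrable_mult_indicator[of A lborel f] assms by (simp add: set_integrable_def)

lemma continuous_prim:
  assumes "integrable lborel f"
  shows "continuous_on A (prim f)"
proof -
  have "isCont (prim f) x" for x
  proof (rule continuous_at_sequentiallyI)
    fix u assume u: "u \<longlonglongrightarrow> x"
    show "(\<lambda>n. prim f (u n)) \<longlonglongrightarrow> prim f x"
      unfolding prim_def set_lebesgue_integral_def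
    proof (rule integral_dominated_convergence[where w="\<lambda>t. norm (f t)"])
      show "AE t in lborel. (\<lambda>n. indicator {..u n} t *\<^sub>R f t) \<longlonglongrightarrow> indicator {..x} t *\<^sub>R f t"
        using AE_lborel_singleton[of x]
      proof eventually_elim
        case (elim t)
        have "\<forall>\<^sub>F n in sequentially. indicator {..u n} t *\<^sub>R f t = indicator {..x} t *\<^sub>R f t"
        proof (cases "t < x")
          case True
          then show ?thesis using order_tendstoD(1)[OF u True] by (auto elim!: eventually_mono)
        next
          case False
          with elim have "x < t" by simp
          then show ?thesis using order_tendstoD(2)[OF u \<open>x < t\<close>] by (auto elim!: eventually_mono)
        qed
        then show ?case by (rule tendsto_eventually)
      qed
    qed (use assms in \<open>auto intro!: borel_measurable_integrable integrable_mult_indicator split: split_indicator\<close>)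
  qed
  then show ?thesis by (simp add: continuous_at_imp_continuous_on)
qed

lemma norm_prim_le:
  assumes "integrable lborel f"
  shows "norm (prim f x) \<le> (LINT t|lborel. norm (f t))"
proof -
  have n: "integrable lborel (\<lambda>t. norm (indicator {..x} t *\<^sub>R f t))"
    using set_integrable_UNIV_subset[OF assms, of "{..x}"] unfolding set_integrable_def
    by (intro integrable_norm) simp
  have "norm (prim f x) \<le> (LINT t|lborel. norm (indicator {..x} t *\<^sub>R f t))"
    unfolding prim_def set_lebesgue_integral_def by (rule integral_norm_bound)
  also have "\<dots> \<le> (LINT t|lborel. norm (f t))"
    by (intro integral_mono n integrable_norm assms) (auto split: split_indicator)
  finally show ?thesis .
qed

lemma borel_measurable_prim: "integrable lborel f \<Longrightarrow> prim f \<in> borel_measurable borel"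
  using continuous_prim[of f UNIV] by (rule borel_measurable_continuous_onI)

lemma integrable_mult_bounded:
  fixes f h :: "'a \<Rightarrow> complex"
  assumes "integrable M f" "h \<in> borel_measurable M" "\<And>x. norm (h x) \<le> B"
  shows "integrable M (\<lambda>x. f x * h x)"
proof (rule Bochner_Integration.integrable_bound[where f="\<lambda>x. B * norm (f x)"])
  show "AE x in M. norm (f x * h x) \<le> norm (B * norm (f x))"
  proof (rule AE_I2)
    fix x
    have "norm (f x * h x) \<le> norm (f x) * B"
      by (simp add: norm_mult mult_left_mono assms(3))
    then show "norm (f x * h x) \<le> norm (B * norm (f x))"
      by (smt (verit, best) mult.commute real_norm_def)
  qed
qed (use assms in \<open>auto intro!: borel_measurable_times borel_measurable_integrable\<close>)

text \<open>Fubini for f s * g t: the half plane s \<le> t gives the term with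
  \<open>prim f\<close>, the complementary half plane the term with \<open>prim g\<close>. This is
  the product rule for primitives without pointwise derivatives.\<close>

lemma integral_by_parts_whole:
  assumes f: "integrable lborel f" and g: "integrable lborel g"
  shows "integral\<^sup>L lborel f * integral\<^sup>L lborel g
    = (LINT t|lborel. f t * prim g t + prim f t * g t)"
proof -
  note [measurable] = borel_measurable_integrable[OF f] borel_measurable_integrable[OF g]
  have int: "integrable (lborel \<Otimes>\<^sub>M lborel) (\<lambda>(t,s). f s * g t * indicator {s..} t)"
  proof (rule lborel_pair.Fubini_integrable)
    show "(\<lambda>(t,s). f s * g t * indicator {s..} t) \<in> borel_measurable (lborel \<Otimes>\<^sub>M lborel)"
      unfolding indicator_def atLeast_iff by measurable
    show "AE t in lborel. integrable lborel (\<lambda>s. case (t,s) of (t,s) \<Rightarrow> f s * g t * indicator {s..} t)"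
    proof (rule AE_I2)
      fix t
      have "integrable lborel (\<lambda>s. g t * (indicator {..t} s *\<^sub>R f s))"
        using set_integrable_UNIV_subset[OF f, of "{..t}"] unfolding set_integrable_def
        by (intro integrable_mult_right) simp
      then show "integrable lborel (\<lambda>s. case (t,s) of (t,s) \<Rightarrow> f s * g t * indicator {s..} t)"
        by (rule back_subst[where P="integrable lborel"]) (auto split: split_indicator)
    qed
    have eq: "(\<integral>s. norm (case (t,s) of (t,s) \<Rightarrow> f s * g t * indicator {s..} t) \<partial>lborel)
        = norm (g t) * norm (LINT s:{..t}|lborel. norm (f s))" for t
    proof -
      have "(\<integral>s. norm (case (t,s) of (t,s) \<Rightarrow> f s * g t * indicator {s..} t) \<partial>lborel)
        = (\<integral>s. norm (g t) * (indicator {..t} s *\<^sub>R norm (f s)) \<partial>lborel)"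
        by (intro Bochner_Integration.integral_cong) (auto simp: norm_mult split: split_indicator)
      also have "\<dots> = norm (g t) * (LINT s:{..t}|lborel. norm (f s))"
        by (simp add: set_lebesgue_integral_def)
      finally show ?thesis by (simp add: set_lebesgue_integral_def integral_nonneg_AE)
    qed
    \<comment> \<open>\<open>prim\<close> is complex valued, so the real integral of the norm is
      read as a real part in order to reuse measurability and the bound for
      \<open>prim\<close>.\<close>
    have cr: "(LINT s:{..t}|lborel. norm (f s)) = Re (prim (\<lambda>s. complex_of_real (norm (f s))) t)" for t
      unfolding prim_def
      by (subst set_integral_complex_of_real) simp
    have fn: "integrable lborel (\<lambda>s. complex_of_real (norm (f s)))"
      using f by simp
    show "integrable lborel (\<lambda>t. \<integral>s. norm (case (t,s) of (t,s) \<Rightarrow> f s * g t * indicator {s..} t) \<partial>lborel)"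
      unfolding eq cr
    proof -
      have "integrable lborel (\<lambda>t. g t * prim (\<lambda>s. complex_of_real (norm (f s))) t)"
        using borel_measurable_prim[OF fn] norm_prim_le[OF fn]
        by (intro integrable_mult_bounded[OF g]) auto
      then have "integrable lborel (\<lambda>t. norm (g t * prim (\<lambda>s. complex_of_real (norm (f s))) t))"
        by (rule integrable_norm)
      moreover have "norm (prim (\<lambda>s. complex_of_real (norm (f s))) t) = norm (Re (prim (\<lambda>s. complex_of_real (norm (f s))) t))" for t
        unfolding prim_def by (subst (1 2) set_integral_complex_of_real) simp
      ultimately show "integrable lborel (\<lambda>t. norm (g t) * norm (Re (prim (\<lambda>s. complex_of_real (norm (f s))) t)))"
        by (simp add: norm_mult)
    qed
  qed
  have Fg: "integrable lborel (\<lambda>t. prim f t * g t)"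
    using integrable_mult_bounded[OF g _ norm_prim_le[OF f]] borel_measurable_prim[OF f]
    by (simp add: mult.commute)
  have fG: "integrable lborel (\<lambda>t. f t * prim g t)"
    using integrable_mult_bounded[OF f _ norm_prim_le[OF g]] borel_measurable_prim[OF g] by simp
  have gf: "set_integrable lborel A g" if "A \<in> sets borel" for A
    using set_integrable_UNIV_subset[OF g that] .
  have "(LINT t|lborel. prim f t * g t) = (LINT t|lborel. LINT s|lborel. f s * g t * indicator {s..} t)"
  proof (intro Bochner_Integration.integral_cong refl)
    fix t
    have "prim f t * g t = (LINT s|lborel. (indicator {..t} s *\<^sub>R f s) * g t)"
      unfolding prim_def set_lebesgue_integral_def by (rule integral_mult_left_zero[symmetric])
    also have "\<dots> = (LINT s|lborel. f s * g t * indicator {s..} t)"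
      by (intro Bochner_Integration.integral_cong) (auto split: split_indicator)
    finally show "prim f t * g t = (LINT s|lborel. f s * g t * indicator {s..} t)" .
  qed
  also have "\<dots> = (LINT s|lborel. LINT t|lborel. f s * g t * indicator {s..} t)"
    using lborel_pair.Fubini_integral[OF int] by simp
  also have "\<dots> = (LINT s|lborel. f s * (integral\<^sup>L lborel g - prim g s))"
  proof (intro Bochner_Integration.integral_cong refl)
    fix s :: real
    have "{..s} \<union> {s<..} = UNIV" by auto
    then have "integral\<^sup>L lborel g = (LINT t:{..s} \<union> {s<..}|lborel. g t)"
      by (simp add: set_lebesgue_integral_def)
    also have "\<dots> = prim g s + (LINT t:{s<..}|lborel. g t)"
      unfolding prim_def by (rule set_integral_Un) (auto intro!: gf)
    also have "(LINT t:{s<..}|lborel. g t) = (LINT t:{s..}|lborel. g t)"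
      by (rule set_integral_discrete_difference[where X="{s}"]) auto
    finally have "integral\<^sup>L lborel g - prim g s = (LINT t:{s..}|lborel. g t)" by simp
    moreover have "(LINT t|lborel. f s * g t * indicator {s..} t) = (LINT t|lborel. f s * (indicator {s..} t *\<^sub>R g t))"
      by (intro Bochner_Integration.integral_cong) (auto split: split_indicator)
    ultimately show "(LINT t|lborel. f s * g t * indicator {s..} t) = f s * (integral\<^sup>L lborel g - prim g s)"
      by (simp only: set_lebesgue_integral_def integral_mult_right_zero)
  qed
  also have "\<dots> = integral\<^sup>L lborel f * integral\<^sup>L lborel g - (LINT s|lborel. f s * prim g s)"
    using f fG by (simp add: right_diff_distrib)
  finally show ?thesis using fG Fg by simp
qed

lemma prim_add:
  assumes "integrable lborel f" "integrable lborel g"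
  shows "prim (\<lambda>t. f t + g t) x = prim f x + prim g x"
  unfolding prim_def using assms by (intro set_integral_add set_integrable_UNIV_subset) auto

lemma prim_cmult: "prim (\<lambda>t. c * f t) x = c * prim f x"
  unfolding prim_def by simp

text \<open>Cutting both factors off at x reduces this to the whole line; at points t \<le> x the
  cut does not change the primitives.\<close>

lemma prim_mult:
  assumes f: "integrable lborel f" and g: "integrable lborel g"
  shows "prim f x * prim g x = prim (\<lambda>t. f t * prim g t + prim f t * g t) x"
proof -
  let ?f = "\<lambda>t. indicator {..x} t *\<^sub>R f t" and ?g = "\<lambda>t. indicator {..x} t *\<^sub>R g t"
  have f': "integrable lborel ?f" and g': "integrable lborel ?g"
    using set_integrable_UNIV_subset[OF f] set_integrable_UNIV_subset[OF g] by (auto simp: set_integrable_def)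
  have *: "prim (\<lambda>t. indicator {..x} t *\<^sub>R h t) t = prim h t" if "t \<le> x" for h t
    unfolding prim_def set_lebesgue_integral_def
    by (intro Bochner_Integration.integral_cong) (use that in \<open>auto split: split_indicator\<close>)
  have "prim f x * prim g x = integral\<^sup>L lborel ?f * integral\<^sup>L lborel ?g"
    by (simp add: prim_def set_lebesgue_integral_def)
  also have "\<dots> = (LINT t|lborel. ?f t * prim ?g t + prim ?f t * ?g t)"
    by (rule integral_by_parts_whole[OF f' g'])
  also have "\<dots> = prim (\<lambda>t. f t * prim g t + prim f t * g t) x"
    unfolding prim_def[of _ x] set_lebesgue_integral_def
    by (intro Bochner_Integration.integral_cong) (auto simp: * split: split_indicator)
  finally show ?thesis .
qed

text \<open>Half-lines form an intersection-stable generator of the Borel sets, so a Dynkin argument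
  extends the vanishing integral from them to all Borel sets. Complements need the total integral
  \<open>cov\<close>, obtained as a limit of \<open>prim f n\<close>.\<close>

lemma AE_zero_of_prim_zero:
  assumes f: "integrable lborel f" and z: "\<And>x. prim f x = 0"
  shows "AE x in lborel. f x = 0"
proof (rule sigma_finite_measure.density_zero[OF sigma_finite_lborel f])
  fix A :: "real set" assume "A \<in> sets lborel"
  have s: "sets lborel = sigma_sets UNIV (range (\<lambda>a::real. {..a}))"
    by (metis borel_eq_atMost sets_lborel sets_measure_of top_greatest Pow_UNIV)
  with \<open>A \<in> sets lborel\<close> have A: "A \<in> sigma_sets UNIV (range (\<lambda>a::real. {..a}))" by simp
  have cov: "integral\<^sup>L lborel f = 0"
  proof -
    have "((\<lambda>n::nat. prim f (real n)) \<longlonglongrightarrow> integral\<^sup>L lborel f)"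
      unfolding prim_def set_lebesgue_integral_def
    proof (rule integral_dominated_convergence[where w="\<lambda>t. norm (f t)"])
      show "AE t in lborel. (\<lambda>n. indicator {..real n} t *\<^sub>R f t) \<longlonglongrightarrow> f t"
      proof (rule AE_I2)
        fix t
        have "\<forall>\<^sub>F n in sequentially. indicator {..real n} t *\<^sub>R f t = f t"
          using eventually_ge_at_top[of "nat \<lceil>t\<rceil>"] by eventually_elim (auto simp: indicator_def nat_le_iff ceiling_le_iff)
        then show "(\<lambda>n. indicator {..real n} t *\<^sub>R f t) \<longlonglongrightarrow> f t" by (rule tendsto_eventually)
      qed
    qed (use f in \<open>auto intro!: borel_measurable_integrable integrable_mult_indicator split: split_indicator\<close>)
    then show ?thesis using z LIMSEQ_unique[of "\<lambda>n. 0"] by auto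
  qed
  have fi: "set_integrable lborel B f" if "B \<in> sigma_sets UNIV (range (\<lambda>a::real. {..a}))" for B
    using set_integrable_UNIV_subset[OF f] that s by auto
  have "Int_stable (range (\<lambda>a::real. {..a}))" by (auto simp: Int_stable_def)
  moreover have "range (\<lambda>a::real. {..a}) \<subseteq> Pow UNIV" by auto
  ultimately show "set_lebesgue_integral lborel A f = 0"
    using A
  proof (induction rule: sigma_sets_induct_disjoint)
    case (basic A) then show ?case using z by (auto simp: prim_def)
  next
    case empty show ?case by (simp add: set_lebesgue_integral_def)
  next
    case (compl A)
    have "integral\<^sup>L lborel f = (LINT t:A \<union> (UNIV - A)|lborel. f t)"
      by (simp add: set_lebesgue_integral_def)
    also have "\<dots> = (LINT t:A|lborel. f t) + (LINT t:UNIV - A|lborel. f t)"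
      using compl(1) by (intro set_integral_Un fi) (auto intro: sigma_sets.Compl)
    finally show ?case using compl(2) cov by simp
  next
    case (union A)
    have "(\<lambda>i. LINT x:A i|lborel. f x) sums (LINT x:(\<Union>i. A i)|lborel. f x)"
    proof -
      have "(LINT x:(\<Union>i. A i)|lborel. f x) = (\<Sum>i. LINT x:A i|lborel. f x)"
        using union(1,2) s by (intro lebesgue_integral_countable_add fi sigma_sets.Union)
          (auto simp: disjoint_family_on_def)
      then show ?thesis using union(3) by simp
    qed
    then show ?case using union(3) by (simp add: sums_iff)
  qed
qed

section \<open>Weak derivatives\<close>

lemma I_int_borel [measurable, simp]: "I_int \<in> sets borel"
  by (simp add: I_int_def)

lemma emeasure_I_int: "emeasure lborel I_int = ennreal (2 * pi)"
  by (simp add: I_int_def)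

lemma set_integrable_const_I: "set_integrable lborel I_int (\<lambda>x. c :: 'b::{banach, second_countable_topology})"
  unfolding set_integrable_def using emeasure_I_int
  by (intro integrable_scaleR_left integrable_real_indicator) auto

lemma L2_mult_integrable:
  assumes "f \<in> L2" "g \<in> L2"
  shows "set_integrable lborel I_int (\<lambda>x. f x * g x)"
proof (rule set_integrable_bound)
  show "set_integrable lborel I_int (\<lambda>x. (cmod (f x))\<^sup>2 + (cmod (g x))\<^sup>2)"
    using assms by (intro set_integral_add) (auto simp: L2_def)
  have m: "(\<lambda>x. indicator I_int x *\<^sub>R f x) \<in> borel_measurable lborel"
    "(\<lambda>x. indicator I_int x *\<^sub>R g x) \<in> borel_measurable lborel"
    using assms by (auto simp: L2_def set_borel_measurable_def)
  show "set_borel_measurable lborel I_int (\<lambda>x. f x * g x)"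
    unfolding set_borel_measurable_def
    by (rule back_subst[where P="\<lambda>h. h \<in> borel_measurable lborel", OF borel_measurable_times[OF m]])
       (auto split: split_indicator)
  show "AE x in lborel. x \<in> I_int \<longrightarrow> norm (f x * g x) \<le> norm ((cmod (f x))\<^sup>2 + (cmod (g x))\<^sup>2)"
  proof (intro AE_I2 impI)
    fix x
    have "2 * (cmod (f x) * cmod (g x)) \<le> (cmod (f x))\<^sup>2 + (cmod (g x))\<^sup>2"
      using sum_squares_bound[of "cmod (f x)" "cmod (g x)"] by simp
    moreover have "0 \<le> cmod (f x) * cmod (g x)" by simp
    ultimately have "cmod (f x) * cmod (g x) \<le> (cmod (f x))\<^sup>2 + (cmod (g x))\<^sup>2"
      by linarith
    then show "norm (f x * g x) \<le> norm ((cmod (f x))\<^sup>2 + (cmod (g x))\<^sup>2)"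
      by (simp add: norm_mult)
  qed
qed

lemma set_bm_mult:
  fixes f g :: "real \<Rightarrow> complex"
  assumes "set_borel_measurable lborel A f" "set_borel_measurable lborel A g"
  shows "set_borel_measurable lborel A (\<lambda>x. f x * g x)"
  unfolding set_borel_measurable_def
  by (rule back_subst[where P="\<lambda>h. h \<in> borel_measurable lborel",
        OF borel_measurable_times[OF assms[unfolded set_borel_measurable_def]]])
     (auto split: split_indicator)

lemma set_bm_cmod_power2:
  fixes f :: "real \<Rightarrow> complex"
  assumes "set_borel_measurable lborel A f"
  shows "set_borel_measurable lborel A (\<lambda>x. (cmod (f x))\<^sup>2)"
  unfolding set_borel_measurable_def
  by (rule back_subst[where P="\<lambda>h. h \<in> borel_measurable lborel",
        OF borel_measurable_power[OF measurable_compose[OF assms[unfolded set_borel_measurable_def] borel_measurable_norm], of 2]])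
     (auto split: split_indicator)

lemma L2_mult_bounded:
  assumes f: "f \<in> L2" and h: "set_borel_measurable lborel I_int h"
    and B: "\<And>x. x \<in> I_int \<Longrightarrow> cmod (h x) \<le> B"
  shows "(\<lambda>x. f x * h x) \<in> L2"
proof -
  have m: "set_borel_measurable lborel I_int (\<lambda>x. f x * h x)"
    using f h by (intro set_bm_mult) (auto simp: L2_def)
  have "set_integrable lborel I_int (\<lambda>x. (cmod (f x * h x))\<^sup>2)"
  proof (rule set_integrable_bound)
    show "set_integrable lborel I_int (\<lambda>x. B\<^sup>2 * (cmod (f x))\<^sup>2)"
      using f by (intro set_integrable_mult_right) (auto simp: L2_def)
    show "set_borel_measurable lborel I_int (\<lambda>x. (cmod (f x * h x))\<^sup>2)"
      by (rule set_bm_cmod_power2[OF m])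
    show "AE x in lborel. x \<in> I_int \<longrightarrow> norm ((cmod (f x * h x))\<^sup>2) \<le> norm (B\<^sup>2 * (cmod (f x))\<^sup>2)"
    proof (intro AE_I2 impI)
      fix x assume "x \<in> I_int"
      then have "(cmod (f x))\<^sup>2 * (cmod (h x))\<^sup>2 \<le> (cmod (f x))\<^sup>2 * B\<^sup>2"
        by (intro mult_left_mono power_mono B) auto
      then show "norm ((cmod (f x * h x))\<^sup>2) \<le> norm (B\<^sup>2 * (cmod (f x))\<^sup>2)"
        by (simp add: norm_mult power_mult_distrib mult.commute)
    qed
  qed
  with m show ?thesis by (simp add: L2_def)
qed

lemma one_L2: "(\<lambda>x. 1) \<in> L2"
  using set_integrable_const_I[of "1::real"] by (simp add: L2_def set_borel_measurable_def)

lemma L2_bounded: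
  assumes "set_borel_measurable lborel I_int h" "\<And>x. x \<in> I_int \<Longrightarrow> cmod (h x) \<le> B"
  shows "h \<in> L2"
  using L2_mult_bounded[OF one_L2 assms] by simp

lemma L2_integrable: "f \<in> L2 \<Longrightarrow> set_integrable lborel I_int f"
  using L2_mult_integrable[OF _ one_L2] by simp

lemma L2_add:
  assumes "f \<in> L2" "g \<in> L2"
  shows "(\<lambda>x. f x + g x) \<in> L2"
proof -
  have m: "(\<lambda>x. indicator I_int x *\<^sub>R f x) \<in> borel_measurable lborel"
    "(\<lambda>x. indicator I_int x *\<^sub>R g x) \<in> borel_measurable lborel"
    using assms by (auto simp: L2_def set_borel_measurable_def)
  have s: "set_borel_measurable lborel I_int (\<lambda>x. f x + g x)"
    unfolding set_borel_measurable_def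
    using borel_measurable_add[OF m] by (simp add: scaleR_add_right)
  have "set_integrable lborel I_int (\<lambda>x. (cmod (f x + g x))\<^sup>2)"
  proof (rule set_integrable_bound)
    show "set_integrable lborel I_int (\<lambda>x. 2 * (cmod (f x))\<^sup>2 + 2 * (cmod (g x))\<^sup>2)"
      using assms by (intro set_integral_add set_integrable_mult_right) (auto simp: L2_def)
    show "set_borel_measurable lborel I_int (\<lambda>x. (cmod (f x + g x))\<^sup>2)"
      by (rule set_bm_cmod_power2[OF s])
    show "AE x in lborel. x \<in> I_int \<longrightarrow> norm ((cmod (f x + g x))\<^sup>2) \<le> norm (2 * (cmod (f x))\<^sup>2 + 2 * (cmod (g x))\<^sup>2)"
    proof (intro AE_I2 impI)
      fix x
      have "(cmod (f x + g x))\<^sup>2 \<le> (cmod (f x) + cmod (g x))\<^sup>2"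
        by (intro power_mono norm_triangle_ineq) auto
      also have "\<dots> \<le> 2 * (cmod (f x))\<^sup>2 + 2 * (cmod (g x))\<^sup>2"
        using sum_squares_bound[of "cmod (f x)" "cmod (g x)"] by (simp add: power2_sum)
      finally show "norm ((cmod (f x + g x))\<^sup>2) \<le> norm (2 * (cmod (f x))\<^sup>2 + 2 * (cmod (g x))\<^sup>2)" by simp
    qed
  qed
  with s show ?thesis by (simp add: L2_def)
qed

lemma L2_cnj: "f \<in> L2 \<Longrightarrow> (\<lambda>x. cnj (f x)) \<in> L2"
proof -
  assume f: "f \<in> L2"
  then have "(\<lambda>x. cnj (indicator I_int x *\<^sub>R f x)) \<in> borel_measurable lborel"
    unfolding L2_def set_borel_measurable_def
    by (intro borel_measurable_continuous_on[OF continuous_on_cnj[OF continuous_on_id]]) auto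
  then show ?thesis using f by (simp add: L2_def set_borel_measurable_def)
qed

text \<open>Cutting off to the interval makes an L2 function integrable on the line, so
  \<open>prim\<close> applies: its primitive is 0 up to 0 and constant from 2 pi on.\<close>

abbreviation ext0 :: "(real \<Rightarrow> complex) \<Rightarrow> real \<Rightarrow> complex" where
  "ext0 g \<equiv> \<lambda>t. indicator I_int t *\<^sub>R g t"

lemma ext0_integrable: "g \<in> L2 \<Longrightarrow> integrable lborel (ext0 g)"
  using L2_integrable by (auto simp: set_integrable_def)

lemma prim_diff_ext0:
  assumes g: "g \<in> L2" and x: "x \<le> y"
  shows "prim (ext0 g) y - prim (ext0 g) x = (LINT t:{x..y}|lborel. ext0 g t)"
proof -
  note i = ext0_integrable[OF g]
  have "prim (ext0 g) y = (LINT t:{..x} \<union> {x<..y}|lborel. ext0 g t)"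
    using x by (simp add: prim_def ivl_disj_un)
  also have "\<dots> = prim (ext0 g) x + (LINT t:{x<..y}|lborel. ext0 g t)"
    unfolding prim_def by (rule set_integral_Un) (auto intro!: set_integrable_UNIV_subset i)
  also have "(LINT t:{x<..y}|lborel. ext0 g t) = (LINT t:{x..y}|lborel. ext0 g t)"
    by (rule set_integral_discrete_difference[where X="{x}"]) auto
  finally show ?thesis by simp
qed

lemma prim_diff:
  assumes g: "g \<in> L2" and x: "x \<in> I_int" "y \<in> I_int" "x \<le> y"
  shows "prim (ext0 g) y - prim (ext0 g) x = (LINT t:{x..y}|lborel. g t)"
  unfolding prim_diff_ext0[OF g x(3)]
  using x by (intro set_lebesgue_integral_cong) (auto simp: I_int_def)

text \<open>The working form of H1: the right side is continuous on the whole line, so limits at 0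
  and 2 pi come from continuity there.\<close>

lemma has_weak_deriv_iff_prim:
  "has_weak_deriv \<psi> g \<longleftrightarrow> g \<in> L2 \<and> (\<exists>c. \<forall>x\<in>I_int. \<psi> x = c + prim (ext0 g) x)"
proof (intro iffI conjI; (elim conjE exE)?)
  assume w: "has_weak_deriv \<psi> g"
  then show g: "g \<in> L2" by (simp add: has_weak_deriv_def)
  have pi: "pi \<in> I_int" by (simp add: I_int_def)
  show "\<exists>c. \<forall>x\<in>I_int. \<psi> x = c + prim (ext0 g) x"
  proof (intro exI ballI)
    fix x assume x: "x \<in> I_int"
    show "\<psi> x = (\<psi> pi - prim (ext0 g) pi) + prim (ext0 g) x"
    proof (cases "x \<le> pi")
      case True
      then have "\<psi> pi - \<psi> x = prim (ext0 g) pi - prim (ext0 g) x"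
        using w x pi unfolding prim_diff[OF g x pi True] by (auto simp: has_weak_deriv_def)
      then show ?thesis by (simp add: algebra_simps)
    next
      case False
      then have "\<psi> x - \<psi> pi = prim (ext0 g) x - prim (ext0 g) pi"
        using w x pi prim_diff[OF g pi x] by (auto simp: has_weak_deriv_def)
      then show ?thesis by (simp add: algebra_simps)
    qed
  qed
next
  fix c assume g: "g \<in> L2" and c: "\<forall>x\<in>I_int. \<psi> x = c + prim (ext0 g) x"
  then show "has_weak_deriv \<psi> g"
    using prim_diff[OF g] by (auto simp: has_weak_deriv_def)
qed

lemma has_weak_deriv_bounded:
  assumes "has_weak_deriv \<psi> g"
  obtains B where "\<And>x. x \<in> I_int \<Longrightarrow> cmod (\<psi> x) \<le> B"
proof -
  obtain c where g: "g \<in> L2" and c: "\<forall>x\<in>I_int. \<psi> x = c + prim (ext0 g) x"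
    using assms by (auto simp: has_weak_deriv_iff_prim)
  have "cmod (\<psi> x) \<le> cmod c + (LINT t|lborel. norm (ext0 g t))" if "x \<in> I_int" for x
    using c that norm_triangle_mono[OF order_refl norm_prim_le[OF ext0_integrable[OF g]]] by simp
  then show thesis by (rule that)
qed

lemma has_weak_deriv_continuous:
  assumes "has_weak_deriv \<psi> g"
  shows "continuous_on I_int \<psi>"
proof -
  obtain c where g: "g \<in> L2" and c: "\<forall>x\<in>I_int. \<psi> x = c + prim (ext0 g) x"
    using assms by (auto simp: has_weak_deriv_iff_prim)
  have "continuous_on I_int (\<lambda>x. c + prim (ext0 g) x)"
    by (intro continuous_intros continuous_prim ext0_integrable g)
  then show ?thesis using c continuous_on_cong[of I_int I_int] by auto
qed

lemma has_weak_deriv_measurable: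
  "has_weak_deriv \<psi> g \<Longrightarrow> set_borel_measurable lborel I_int \<psi>"
  using borel_measurable_continuous_on_indicator[OF I_int_borel has_weak_deriv_continuous]
  by (simp add: set_borel_measurable_def)

lemma has_weak_deriv_L2:
  assumes "has_weak_deriv \<psi> g" shows "\<psi> \<in> L2"
  using has_weak_deriv_bounded[OF assms] L2_bounded[OF has_weak_deriv_measurable[OF assms]] by metis

text \<open>Expanding (c + G)(d + H) leaves GH as the only nonlinear term, which
  \<open>prim_mult\<close> settles. Boundedness of both functions keeps the derivative in
  L2.\<close>

lemma has_weak_deriv_mult:
  assumes w1: "has_weak_deriv \<psi> g" and w2: "has_weak_deriv \<xi> h"
  shows "has_weak_deriv (\<lambda>x. \<psi> x * \<xi> x) (\<lambda>x. g x * \<xi> x + \<psi> x * h x)"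
proof -
  obtain c where g: "g \<in> L2" and c: "\<forall>x\<in>I_int. \<psi> x = c + prim (ext0 g) x"
    using w1 by (auto simp: has_weak_deriv_iff_prim)
  obtain d where h: "h \<in> L2" and d: "\<forall>x\<in>I_int. \<xi> x = d + prim (ext0 h) x"
    using w2 by (auto simp: has_weak_deriv_iff_prim)
  obtain B1 B2 where B: "\<And>x. x \<in> I_int \<Longrightarrow> cmod (\<psi> x) \<le> B1" "\<And>x. x \<in> I_int \<Longrightarrow> cmod (\<xi> x) \<le> B2"
    using has_weak_deriv_bounded w1 w2 by metis
  let ?d = "\<lambda>x. g x * \<xi> x + \<psi> x * h x"
  have l: "(\<lambda>x. g x * \<xi> x) \<in> L2" "(\<lambda>x. \<psi> x * h x) \<in> L2"
    using L2_mult_bounded[OF g has_weak_deriv_measurable[OF w2] B(2)]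
      L2_mult_bounded[OF h has_weak_deriv_measurable[OF w1] B(1)] by (auto simp: mult.commute)
  note g' = ext0_integrable[OF g] and h' = ext0_integrable[OF h]
  let ?p = "\<lambda>t. ext0 g t * prim (ext0 h) t + prim (ext0 g) t * ext0 h t"
  have i1: "integrable lborel (\<lambda>t. ext0 g t * prim (ext0 h) t)"
    using integrable_mult_bounded[OF g' _ norm_prim_le[OF h']] borel_measurable_prim[OF h'] by simp
  have i2: "integrable lborel (\<lambda>t. prim (ext0 g) t * ext0 h t)"
    using integrable_mult_bounded[OF h' _ norm_prim_le[OF g']] borel_measurable_prim[OF g'] by (simp add: mult.commute)
  have "\<psi> x * \<xi> x = c * d + prim (ext0 ?d) x" if x: "x \<in> I_int" for x
  proof -
    have "ext0 ?d = (\<lambda>t. (c * ext0 h t + d * ext0 g t) + ?p t)"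
      using c d by (auto split: split_indicator simp: algebra_simps)
    then have "prim (ext0 ?d) x = prim (\<lambda>t. (c * ext0 h t + d * ext0 g t) + ?p t) x"
      by simp
    also have "\<dots> = c * prim (ext0 h) x + d * prim (ext0 g) x + prim ?p x"
    proof -
      have a: "integrable lborel (\<lambda>t. c * ext0 h t)" "integrable lborel (\<lambda>t. d * ext0 g t)"
        by (rule integrable_mult_right, rule h', rule integrable_mult_right, rule g')
      show ?thesis
        using prim_add[OF Bochner_Integration.integrable_add[OF a] Bochner_Integration.integrable_add[OF i1 i2], of x]
        by (simp only: prim_add[OF a] prim_cmult)
    qed
    also have "prim ?p x = prim (ext0 g) x * prim (ext0 h) x"
      by (rule prim_mult[OF g' h', symmetric])
    finally show ?thesis using c d x by (simp add: algebra_simps)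
  qed
  then show ?thesis using L2_add[OF l] by (auto simp: has_weak_deriv_iff_prim)
qed

lemma has_weak_deriv_cnj:
  assumes "has_weak_deriv \<psi> g"
  shows "has_weak_deriv (\<lambda>x. cnj (\<psi> x)) (\<lambda>x. cnj (g x))"
proof -
  have "(LINT t:A|lborel. cnj (g t)) = cnj (LINT t:A|lborel. g t)" for A
    unfolding set_lebesgue_integral_def
    by (subst Bochner_Integration.integral_cnj[symmetric]) (auto intro!: Bochner_Integration.integral_cong)
  then show ?thesis using assms L2_cnj[of g]
    unfolding has_weak_deriv_def by (metis complex_cnj_diff)
qed

lemma has_weak_deriv_limits:
  assumes "has_weak_deriv \<psi> g"
  obtains c where "g \<in> L2" "\<And>x. x \<in> I_int \<Longrightarrow> \<psi> x = c + prim (ext0 g) x"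
    "(\<psi> \<longlongrightarrow> c) (at_right 0)" "(\<psi> \<longlongrightarrow> c + prim (ext0 g) (2 * pi)) (at_left (2 * pi))"
proof -
  obtain c where g: "g \<in> L2" and c: "\<forall>x\<in>I_int. \<psi> x = c + prim (ext0 g) x"
    using assms by (auto simp: has_weak_deriv_iff_prim)
  let ?P = "\<lambda>x. c + prim (ext0 g) x"
  have cont: "isCont ?P x" for x
    using continuous_on_add[OF continuous_on_const[of UNIV c] continuous_prim[OF ext0_integrable[OF g], of UNIV]]
    by (simp add: continuous_on_eq_continuous_at)
  have "prim (ext0 g) 0 = (LINT t:{..0::real}|lborel. 0)"
    unfolding prim_def by (intro set_lebesgue_integral_cong) (auto simp: I_int_def)
  then have p0: "prim (ext0 g) 0 = 0" by simp
  have "(\<psi> \<longlongrightarrow> ?P 0) (at_right 0)"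
  proof (rule Lim_transform_eventually)
    show "(?P \<longlongrightarrow> ?P 0) (at_right 0)"
      using cont[of 0] by (auto simp: continuous_at intro: tendsto_within_subset)
    show "\<forall>\<^sub>F x in at_right 0. ?P x = \<psi> x"
      using c by (auto simp: eventually_at_right[of 0 "2*pi"] I_int_def intro!: exI[of _ "2*pi"])
  qed
  moreover have "(\<psi> \<longlongrightarrow> ?P (2*pi)) (at_left (2*pi))"
  proof (rule Lim_transform_eventually)
    show "(?P \<longlongrightarrow> ?P (2*pi)) (at_left (2*pi))"
      using cont[of "2*pi"] by (auto simp: continuous_at intro: tendsto_within_subset)
    show "\<forall>\<^sub>F x in at_left (2*pi). ?P x = \<psi> x"
      using c by (auto simp: eventually_at_left[of 0 "2*pi"] I_int_def intro!: exI[of _ 0])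
  qed
  ultimately show thesis using that g c p0 by simp
qed

lemma has_weak_deriv_integral:
  assumes w: "has_weak_deriv \<psi> g" and l: "(\<psi> \<longlongrightarrow> l) (at_right 0)" and r: "(\<psi> \<longlongrightarrow> r) (at_left (2 * pi))"
  shows "(LINT x:I_int|lborel. g x) = r - l"
proof -
  obtain c where c: "(\<psi> \<longlongrightarrow> c) (at_right 0)" "(\<psi> \<longlongrightarrow> c + prim (ext0 g) (2 * pi)) (at_left (2 * pi))"
    using has_weak_deriv_limits[OF w] .
  have "l = c" "r = c + prim (ext0 g) (2 * pi)"
    using tendsto_unique[OF _ l c(1)] tendsto_unique[OF _ r c(2)] by auto
  moreover have "prim (ext0 g) (2*pi) = (LINT x:I_int|lborel. g x)"
    unfolding prim_def set_lebesgue_integral_def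
    by (intro Bochner_Integration.integral_cong) (auto simp: I_int_def split: split_indicator)
  ultimately show ?thesis by simp
qed

text \<open>Pairs the derivative with the step function starting at y; this is how a point
  interaction enters the weak form.\<close>

lemma has_weak_deriv_integral_tail:
  assumes w: "has_weak_deriv \<psi> g" and y: "y \<in> I_int" and r: "(\<psi> \<longlongrightarrow> r) (at_left (2 * pi))"
  shows "(LINT x:I_int|lborel. if y \<le> x then g x else 0) = r - \<psi> y"
proof -
  obtain c where c: "g \<in> L2" "\<And>x. x \<in> I_int \<Longrightarrow> \<psi> x = c + prim (ext0 g) x"
    "(\<psi> \<longlongrightarrow> c + prim (ext0 g) (2 * pi)) (at_left (2 * pi))"
    using has_weak_deriv_limits[OF w] by metis
  have "r - \<psi> y = prim (ext0 g) (2 * pi) - prim (ext0 g) y"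
    using tendsto_unique[OF _ r c(3)] c(2)[OF y] by simp
  also have "\<dots> = (LINT t:{y..2*pi}|lborel. ext0 g t)"
    using y by (intro prim_diff_ext0[OF c(1)]) (auto simp: I_int_def)
  also have "\<dots> = (LINT x:I_int|lborel. if y \<le> x then g x else 0)"
    using y unfolding set_lebesgue_integral_def
    by (intro Bochner_Integration.integral_cong) (auto simp: I_int_def split: split_indicator)
  finally show ?thesis ..
qed

text \<open>The two primitives differ by a constant on the interval. Continuity carries this to the
  point 0, where both vanish, so the primitive of the difference is 0 everywhere.\<close>

lemma has_weak_deriv_unique:
  assumes "has_weak_deriv \<psi> g" "has_weak_deriv \<psi> h"
  shows "AE x in lborel. ext0 g x = ext0 h x"
proof -
  obtain c where g: "g \<in> L2" and c: "\<forall>x\<in>I_int. \<psi> x = c + prim (ext0 g) x"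
    using assms(1) by (auto simp: has_weak_deriv_iff_prim)
  obtain d where h: "h \<in> L2" and d: "\<forall>x\<in>I_int. \<psi> x = d + prim (ext0 h) x"
    using assms(2) by (auto simp: has_weak_deriv_iff_prim)
  let ?D = "\<lambda>x. ext0 g x - ext0 h x"
  note g' = ext0_integrable[OF g] and h' = ext0_integrable[OF h]
  have D: "integrable lborel ?D" using g' h' by simp
  have Dp: "prim ?D x = prim (ext0 g) x - prim (ext0 h) x" for x
    unfolding prim_def
    using set_integrable_UNIV_subset[OF g', of "{..x}"] set_integrable_UNIV_subset[OF h', of "{..x}"]
    by simp
  have out: "prim ?D x = 0" if "x \<le> 0" for x
  proof -
    have "prim ?D x = (LINT t:{..x}|lborel. 0)"
      unfolding prim_def using that by (intro set_lebesgue_integral_cong) (auto simp: I_int_def)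
    then show ?thesis by simp
  qed
  have cont: "isCont (prim ?D) x" for x
    using continuous_on_eq_continuous_at[of UNIV] continuous_prim[OF D, of UNIV] by auto
  have const: "prim ?D x = d - c" if "x \<in> I_int" for x
  proof -
    have "c + prim (ext0 g) x = d + prim (ext0 h) x" using c d that by metis
    then show ?thesis unfolding Dp by algebra
  qed
  have cl: "prim ?D x = d - c" if "x \<in> {0..2*pi}" for x
  proof -
    have "closed {x. prim ?D x = d - c}"
      using continuous_prim[OF D, of UNIV] by (intro closed_Collect_eq) auto
    then have "closure I_int \<subseteq> {x. prim ?D x = d - c}"
      using const by (intro closure_minimal) auto
    then show ?thesis using that by (auto simp: I_int_def)
  qed
  have dc: "d - c = 0" using cl[of 0] out[of 0] by simp
  have "prim ?D x = 0" for x
  proof (cases "x \<le> 2*pi")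
    case True then show ?thesis using out[of x] cl[of x] dc by force
  next
    case False
    have "prim ?D x = prim ?D (2*pi)"
      unfolding prim_def set_lebesgue_integral_def using False
      by (intro Bochner_Integration.integral_cong) (auto simp: I_int_def split: split_indicator)
    then show ?thesis using cl[of "2*pi"] dc by simp
  qed
  from AE_zero_of_prim_zero[OF D this] show ?thesis by eventually_elim simp
qed

text \<open>\<open>weak_deriv\<close> is an arbitrary choice; under an integral it may be exchanged
  for an explicit derivative.\<close>

lemma L2_inner_cong_weak:
  assumes "f \<in> L2" "has_weak_deriv \<psi> g" "has_weak_deriv \<psi> h"
  shows "(LINT x:I_int|lborel. f x * g x) = (LINT x:I_int|lborel. f x * h x)"
proof -
  have gh: "g \<in> L2" "h \<in> L2" using assms by (auto simp: has_weak_deriv_def)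
  show ?thesis unfolding set_lebesgue_integral_def
  proof (rule integral_cong_AE)
    show "(\<lambda>x. indicator I_int x *\<^sub>R (f x * g x)) \<in> borel_measurable lborel"
      "(\<lambda>x. indicator I_int x *\<^sub>R (f x * h x)) \<in> borel_measurable lborel"
      using L2_mult_integrable[OF assms(1)] gh by (auto simp: set_integrable_def intro!: borel_measurable_integrable)
    show "AE x in lborel. indicator I_int x *\<^sub>R (f x * g x) = indicator I_int x *\<^sub>R (f x * h x)"
      using has_weak_deriv_unique[OF assms(2,3)] by eventually_elim (auto split: split_indicator_asm)
  qed
qed

text \<open>The bridge from classical piecewise solutions to H1: the fundamental theorem of calculus
  tolerates finitely many exceptional points.\<close>

lemma has_weak_deriv_piecewise:
  fixes f :: "real \<Rightarrow> complex"
  assumes S: "finite S" and f: "continuous_on I_int f" and f': "f' \<in> L2"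
    and d: "\<And>x. x \<in> I_int - S \<Longrightarrow> (f has_vector_derivative f' x) (at x)"
  shows "has_weak_deriv f f'"
  unfolding has_weak_deriv_def
proof (intro conjI ballI impI f')
  fix x y assume xy: "x \<in> I_int" "y \<in> I_int" "x \<le> y"
  have sub: "{x..y} \<subseteq> I_int" using xy by (auto simp: I_int_def)
  have "(f' has_integral f y - f x) {x..y}"
  proof (intro fundamental_theorem_of_calculus_interior_strong[OF S] continuous_on_subset[OF f sub])
    fix z assume "z \<in> {x<..<y} - S"
    then have "z \<in> {x..y}" "z \<notin> S" by auto
    with sub show "(f has_vector_derivative f' z) (at z)" by (intro d) auto
  qed (use xy in auto)
  moreover have "set_integrable lborel {x..y} f'"
    by (rule set_integrable_subset[OF L2_integrable[OF f']]) (use sub in auto)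
  ultimately show "f y - f x = (LINT t:{x..y}|lborel. f' t)"
    by (simp add: set_borel_integral_eq_integral integral_unique)
qed

section \<open>Positive eigenfunctions\<close>

lemma has_weak_deriv_weak_deriv: "\<psi> \<in> H1 \<Longrightarrow> has_weak_deriv \<psi> (weak_deriv \<psi>)"
  unfolding H1_def weak_deriv_def using someI_ex[of "has_weak_deriv \<psi>"] by simp

lemma L2_inner_self: "L2_inner f f = of_real (LINT x:I_int|lborel. (cmod (f x))\<^sup>2)"
proof -
  have "L2_inner f f = (LINT x:I_int|lborel. of_real ((cmod (f x))\<^sup>2))"
    unfolding L2_inner_def by (metis (no_types) complex_norm_square mult.commute)
  then show ?thesis by (simp only: set_integral_complex_of_real)
qed

lemma L2_norm_pos:
  assumes "f \<in> L2" "\<not> (AE x\<in>I_int in lborel. f x = 0)"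
  shows "0 < (LINT x:I_int|lborel. (cmod (f x))\<^sup>2)"
proof -
  have i: "integrable lborel (\<lambda>x. indicator I_int x *\<^sub>R (cmod (f x))\<^sup>2)"
    using assms(1) by (simp add: L2_def set_integrable_def)
  have "(LINT x:I_int|lborel. (cmod (f x))\<^sup>2) \<noteq> 0"
  proof
    assume "(LINT x:I_int|lborel. (cmod (f x))\<^sup>2) = 0"
    then have "AE x in lborel. indicator I_int x *\<^sub>R (cmod (f x))\<^sup>2 = 0"
      using integral_nonneg_eq_0_iff_AE[OF i] by (simp add: set_lebesgue_integral_def)
    then have "AE x\<in>I_int in lborel. f x = 0"
      by eventually_elim (auto split: split_indicator_asm)
    with assms(2) show False by simp
  qed
  moreover have "0 \<le> (LINT x:I_int|lborel. (cmod (f x))\<^sup>2)"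
    unfolding set_lebesgue_integral_def by (intro integral_nonneg_AE) auto
  ultimately show ?thesis by simp
qed

text \<open>A positive classical solution u with u' = g. The jump of g by \<alpha> u(y) at each y in
  Y is encoded without one-sided limits: g minus the step function that collects these jumps must be
  continuous, and its derivative off Y carries the equation.\<close>

locale ground_state =
  fixes Y :: "real set" and \<alpha> \<kappa> :: real and u g :: "real \<Rightarrow> real"
  assumes fin: "finite Y" and sub: "Y \<subseteq> {0<..<2*pi}"
    and u_cont: "continuous_on {0..2*pi} u"
    and u_pos: "\<And>x. x \<in> {0..2*pi} \<Longrightarrow> 0 < u x"
    and u_deriv: "\<And>x. x \<in> {0<..<2*pi} - Y \<Longrightarrow> (u has_real_derivative g x) (at x)"
    and flux_cont: "continuous_on {0..2*pi} (\<lambda>x. g x - (\<Sum>y\<in>Y. if y \<le> x then \<alpha> * u y else 0))"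
    and flux_deriv: "\<And>x. x \<in> {0<..<2*pi} - Y \<Longrightarrow>
      ((\<lambda>x. g x - (\<Sum>y\<in>Y. if y \<le> x then \<alpha> * u y else 0)) has_real_derivative - \<kappa> * u x) (at x)"
    and u_per: "u (2*pi) = u 0" and g_per: "g (2*pi) = g 0"
begin

definition jump :: "real \<Rightarrow> real" where
  "jump x = (\<Sum>y\<in>Y. if y \<le> x then \<alpha> * u y else 0)"

definition flux :: "real \<Rightarrow> real" where
  "flux x = g x - jump x"

abbreviation uc :: "real \<Rightarrow> complex" where "uc \<equiv> \<lambda>x. of_real (u x)"
abbreviation gc :: "real \<Rightarrow> complex" where "gc \<equiv> \<lambda>x. of_real (g x)"

lemma I_sub: "I_int \<subseteq> {0..2*pi}"
  by (auto simp: I_int_def)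

lemma cont_bound:
  assumes "continuous_on {0..2*pi} (f :: real \<Rightarrow> real)"
  obtains B where "\<And>x. x \<in> I_int \<Longrightarrow> \<bar>f x\<bar> \<le> B"
proof -
  have "bounded (f ` {0..2*pi})"
    by (intro compact_imp_bounded compact_continuous_image assms) auto
  then obtain B where "\<forall>x\<in>{0..2*pi}. \<bar>f x\<bar> \<le> B"
    unfolding bounded_iff by (auto simp only: ball_simps real_norm_def)
  then show thesis using that I_sub by blast
qed

lemma cont_L2:
  assumes "continuous_on {0..2*pi} (f :: real \<Rightarrow> real)"
  shows "(\<lambda>x. complex_of_real (f x)) \<in> L2"
proof -
  obtain B where B: "\<And>x. x \<in> I_int \<Longrightarrow> \<bar>f x\<bar> \<le> B" using cont_bound[OF assms] by blast
  have "continuous_on I_int (\<lambda>x. complex_of_real (f x))"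
    by (intro continuous_intros continuous_on_subset[OF assms I_sub])
  then show ?thesis
    using B by (intro L2_bounded[of _ B])
      (auto simp: set_borel_measurable_def borel_measurable_continuous_on_indicator)
qed

lemma jump_L2: "(\<lambda>x. complex_of_real (jump x)) \<in> L2"
proof (rule L2_bounded)
  have "jump \<in> borel_measurable borel"
    unfolding jump_def by measurable
  then show "set_borel_measurable lborel I_int (\<lambda>x. complex_of_real (jump x))"
    unfolding set_borel_measurable_def by measurable
  fix x
  have "\<bar>jump x\<bar> \<le> (\<Sum>y\<in>Y. \<bar>if y \<le> x then \<alpha> * u y else 0\<bar>)"
    unfolding jump_def by (rule sum_abs)
  also have "\<dots> \<le> (\<Sum>y\<in>Y. \<bar>\<alpha> * u y\<bar>)" by (intro sum_mono) auto
  finally show "cmod (complex_of_real (jump x)) \<le> (\<Sum>y\<in>Y. \<bar>\<alpha> * u y\<bar>)" by simp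
qed

lemma flux_L2: "(\<lambda>x. complex_of_real (flux x)) \<in> L2"
  using cont_L2[OF flux_cont] by (simp add: flux_def jump_def)

lemma gc_L2: "gc \<in> L2"
  using L2_add[OF flux_L2 jump_L2] by (simp add: flux_def)

lemma uc_weak: "has_weak_deriv uc gc"
proof (rule has_weak_deriv_piecewise[OF fin _ gc_L2])
  show "continuous_on I_int uc"
    by (intro continuous_intros continuous_on_subset[OF u_cont I_sub])
  show "(uc has_vector_derivative gc x) (at x)" if "x \<in> I_int - Y" for x
    using u_deriv[of x] that by (auto simp: I_int_def intro!: has_vector_derivative_of_real)
qed

lemma flux_weak: "has_weak_deriv (\<lambda>x. of_real (flux x)) (\<lambda>x. of_real (- \<kappa> * u x))"
proof (rule has_weak_deriv_piecewise[OF fin])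
  show "continuous_on I_int (\<lambda>x. complex_of_real (flux x))"
    unfolding flux_def jump_def
    by (intro continuous_on_of_real continuous_on_subset[OF flux_cont I_sub])
  show "(\<lambda>x. complex_of_real (- \<kappa> * u x)) \<in> L2"
    by (intro cont_L2 continuous_intros u_cont)
  show "((\<lambda>x. complex_of_real (flux x)) has_vector_derivative of_real (- \<kappa> * u x)) (at x)"
    if "x \<in> I_int - Y" for x
    using flux_deriv[of x] that
    by (intro has_vector_derivative_of_real) (auto simp: I_int_def flux_def jump_def)
qed

lemma ends:
  assumes "continuous_on {0..2*pi} (f :: real \<Rightarrow> real)"
  shows "((\<lambda>x. complex_of_real (f x)) \<longlongrightarrow> of_real (f 0)) (at_right 0)"
    "((\<lambda>x. complex_of_real (f x)) \<longlongrightarrow> of_real (f (2*pi))) (at_left (2*pi))"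
proof -
  have "(f \<longlongrightarrow> f 0) (at 0 within {0..2*pi})" "(f \<longlongrightarrow> f (2*pi)) (at (2*pi) within {0..2*pi})"
    using assms by (auto simp: continuous_on_def)
  then have "(f \<longlongrightarrow> f 0) (at_right 0)" "(f \<longlongrightarrow> f (2*pi)) (at_left (2*pi))"
    by (simp_all add: at_within_Icc_at_right at_within_Icc_at_left)
  then show "((\<lambda>x. complex_of_real (f x)) \<longlongrightarrow> of_real (f 0)) (at_right 0)"
    "((\<lambda>x. complex_of_real (f x)) \<longlongrightarrow> of_real (f (2*pi))) (at_left (2*pi))"
    by (auto intro: tendsto_of_real)
qed

lemma uc_form_dom: "uc \<in> form_dom"
  using uc_weak ends[OF u_cont] u_per by (auto simp: form_dom_def H1_def)

lemma flux_ends: "flux (2*pi) - flux 0 = - (\<Sum>y\<in>Y. \<alpha> * u y)"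
proof -
  have "jump (2*pi) = (\<Sum>y\<in>Y. \<alpha> * u y)"
    unfolding jump_def using sub by (intro sum.cong) auto
  moreover have "jump 0 = 0"
    unfolding jump_def using sub by (intro sum.neutral) auto
  ultimately show ?thesis using g_per by (simp add: flux_def)
qed

text \<open>Split g = flux + jump. The product rule handles the flux and yields the \<kappa> term,
  tail integrals handle the steps and yield the \<alpha> term. The boundary terms cancel because the
  flux loses around the loop exactly what the steps gain.\<close>

lemma weak_form:
  assumes w: "has_weak_deriv \<phi> h" and l: "(\<phi> \<longlongrightarrow> l) (at_right 0)" "(\<phi> \<longlongrightarrow> l) (at_left (2*pi))"
  shows "(LINT x:I_int|lborel. h x * gc x) + of_real \<alpha> * (\<Sum>y\<in>Y. \<phi> y * uc y)
    = of_real \<kappa> * (LINT x:I_int|lborel. \<phi> x * uc x)"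
proof -
  have h: "h \<in> L2" using w by (simp add: has_weak_deriv_def)
  have uL: "uc \<in> L2" using has_weak_deriv_L2[OF uc_weak] .
  have pL: "\<phi> \<in> L2" using has_weak_deriv_L2[OF w] .
  have ec: "continuous_on {0..2*pi} flux" using flux_cont by (simp add: flux_def[abs_def] jump_def)
  have "(LINT x:I_int|lborel. h x * of_real (flux x) + \<phi> x * of_real (- \<kappa> * u x))
      = l * of_real (flux (2*pi)) - l * of_real (flux 0)"
    by (rule has_weak_deriv_integral[OF has_weak_deriv_mult[OF w flux_weak]])
      (intro tendsto_mult l ends[OF ec])+
  also have "\<dots> = - l * (\<Sum>y\<in>Y. of_real (\<alpha> * u y))"
  proof -
    have "l * of_real (flux (2*pi)) - l * of_real (flux 0) = l * of_real (flux (2*pi) - flux 0)"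
      by (simp add: right_diff_distrib)
    then show ?thesis unfolding flux_ends by simp
  qed
  finally have 0: "(LINT x:I_int|lborel. h x * of_real (flux x) + \<phi> x * of_real (- \<kappa> * u x))
      = - l * (\<Sum>y\<in>Y. of_real (\<alpha> * u y))" .
  have "(LINT x:I_int|lborel. h x * of_real (flux x) + \<phi> x * of_real (- \<kappa> * u x))
    = (LINT x:I_int|lborel. h x * of_real (flux x) - of_real \<kappa> * (\<phi> x * uc x))"
    by (simp add: algebra_simps)
  also have "\<dots> = (LINT x:I_int|lborel. h x * of_real (flux x)) - (LINT x:I_int|lborel. of_real \<kappa> * (\<phi> x * uc x))"
    by (intro set_integral_diff set_integrable_mult_right L2_mult_integrable h flux_L2 pL uL)
  finally have 1: "(LINT x:I_int|lborel. h x * of_real (flux x)) - of_real \<kappa> * (LINT x:I_int|lborel. \<phi> x * uc x)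
      = - l * (\<Sum>y\<in>Y. of_real (\<alpha> * u y))"
    using 0 by simp
  have hi: "set_integrable lborel I_int (\<lambda>x. if y \<le> x then h x else 0)" for y
  proof -
    have "set_integrable lborel (I_int \<inter> {y..}) h"
      by (rule set_integrable_subset[OF L2_integrable[OF h]]) auto
    then show ?thesis
      unfolding set_integrable_def
      by (rule back_subst[where P="integrable lborel"]) (auto split: split_indicator)
  qed
  \<comment> \<open>Each step of \<open>jump\<close> contributes a tail integral of h, which equals
    l - \<phi>(y).\<close>
  have "(LINT x:I_int|lborel. h x * of_real (jump x))
      = (LINT x:I_int|lborel. \<Sum>y\<in>Y. of_real (\<alpha> * u y) * (if y \<le> x then h x else 0))"
    by (intro set_lebesgue_integral_cong)
      (auto simp: jump_def sum_distrib_left intro!: sum.cong)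
  also have "\<dots> = (\<Sum>y\<in>Y. LINT x:I_int|lborel. of_real (\<alpha> * u y) * (if y \<le> x then h x else 0))"
    unfolding set_lebesgue_integral_def scaleR_sum_right
    using hi by (intro Bochner_Integration.integral_sum)
      (simp add: set_integrable_def[symmetric] del: of_real_mult)
  also have "\<dots> = (\<Sum>y\<in>Y. of_real (\<alpha> * u y) * (l - \<phi> y))"
  proof (intro sum.cong refl)
    fix y assume "y \<in> Y"
    then have "y \<in> I_int" using sub by (auto simp: I_int_def)
    then show "(LINT x:I_int|lborel. of_real (\<alpha> * u y) * (if y \<le> x then h x else 0)) = of_real (\<alpha> * u y) * (l - \<phi> y)"
      using has_weak_deriv_integral_tail[OF w _ l(2), of y] by simp
  qed
  also have "\<dots> = l * (\<Sum>y\<in>Y. of_real (\<alpha> * u y)) - of_real \<alpha> * (\<Sum>y\<in>Y. \<phi> y * uc y)"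
    by (simp add: right_diff_distrib sum_subtractf sum_distrib_left algebra_simps)
  finally have 2: "(LINT x:I_int|lborel. h x * of_real (jump x))
      = l * (\<Sum>y\<in>Y. of_real (\<alpha> * u y)) - of_real \<alpha> * (\<Sum>y\<in>Y. \<phi> y * uc y)" .
  have "(LINT x:I_int|lborel. h x * gc x)
      = (LINT x:I_int|lborel. h x * of_real (flux x) + h x * of_real (jump x))"
    by (simp add: flux_def algebra_simps)
  also have "\<dots> = (LINT x:I_int|lborel. h x * of_real (flux x)) + (LINT x:I_int|lborel. h x * of_real (jump x))"
    by (intro set_integral_add L2_mult_integrable h flux_L2 jump_L2)
  finally show ?thesis using 1 2 by (simp add: algebra_simps)
qed

lemma eigenvalue: "is_eigenvalue \<alpha> Y (of_real \<kappa>)"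
  unfolding is_eigenvalue_def
proof (intro exI conjI)
  show "\<not> (AE x\<in>I_int in lborel. uc x = 0)"
  proof
    assume "AE x\<in>I_int in lborel. uc x = 0"
    then have "AE x in lborel. x \<notin> I_int"
      by eventually_elim (use u_pos I_sub in force)
    then have "emeasure lborel I_int = 0"
      using AE_iff_measurable[of I_int lborel "\<lambda>x. x \<notin> I_int"] by auto
    then show False using emeasure_I_int by simp
  qed
  show "H_op \<alpha> Y uc (\<lambda>x. of_real \<kappa> * uc x)"
    unfolding H_op_def
  proof (intro conjI ballI uc_form_dom)
    show "(\<lambda>x. of_real \<kappa> * uc x) \<in> L2"
      using cont_L2[OF continuous_on_mult_left[OF u_cont, of \<kappa>]] by simp
    fix \<phi> assume "\<phi> \<in> form_dom"
    then obtain l where p: "\<phi> \<in> H1" and l: "(\<phi> \<longlongrightarrow> l) (at_right 0)" "(\<phi> \<longlongrightarrow> l) (at_left (2*pi))"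
      by (auto simp: form_dom_def)
    note w = has_weak_deriv_cnj[OF has_weak_deriv_weak_deriv[OF p]]
    have u1: "uc \<in> H1" using uc_weak by (auto simp: H1_def)
    have "L2_inner (weak_deriv \<phi>) (weak_deriv uc) = (LINT x:I_int|lborel. cnj (weak_deriv \<phi> x) * gc x)"
      unfolding L2_inner_def
      using w by (intro L2_inner_cong_weak[OF _ has_weak_deriv_weak_deriv[OF u1] uc_weak])
        (auto simp: has_weak_deriv_def)
    moreover have "L2_inner \<phi> (\<lambda>x. of_real \<kappa> * uc x) = of_real \<kappa> * (LINT x:I_int|lborel. cnj (\<phi> x) * uc x)"
      unfolding L2_inner_def by (simp add: mult.left_commute)
    ultimately show "q_form \<alpha> Y \<phi> uc = L2_inner \<phi> (\<lambda>x. of_real \<kappa> * uc x)"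
      unfolding q_form_def
      using weak_form[OF w tendsto_cnj[OF l(1)] tendsto_cnj[OF l(2)]] by simp
  qed
qed

text \<open>Picone's identity: the weak form is tested with \<open>\<bar>\<phi>\<bar>\<^sup>2 / u\<close>.\<close>

lemma lower_bound:
  assumes w: "has_weak_deriv \<phi> h" and l: "(\<phi> \<longlongrightarrow> l) (at_right 0)" "(\<phi> \<longlongrightarrow> l) (at_left (2*pi))"
  shows "\<kappa> * (LINT x:I_int|lborel. (cmod (\<phi> x))\<^sup>2)
    \<le> (LINT x:I_int|lborel. (cmod (h x))\<^sup>2) + \<alpha> * (\<Sum>y\<in>Y. (cmod (\<phi> y))\<^sup>2)"
proof -
  have u0: "u x \<noteq> 0" if "x \<in> {0..2*pi}" for x using u_pos[OF that] by simp
  have hL: "h \<in> L2" using w by (simp add: has_weak_deriv_def)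
  let ?v = "\<lambda>x. 1 / u x"
  let ?k = "\<lambda>x. - (g x / (u x)\<^sup>2)"
  have vc: "continuous_on {0..2*pi} ?v" using u0 by (intro continuous_intros u_cont) auto
  have v2c: "continuous_on {0..2*pi} (\<lambda>x. - (?v x)\<^sup>2)" by (intro continuous_intros vc)
  have kL: "(\<lambda>x. complex_of_real (?k x)) \<in> L2"
  proof -
    obtain B where B: "\<And>x. x \<in> I_int \<Longrightarrow> \<bar>- (?v x)\<^sup>2\<bar> \<le> B" using cont_bound[OF v2c] by blast
    have "(\<lambda>x. gc x * complex_of_real (- (?v x)\<^sup>2)) \<in> L2"
      using cont_L2[OF v2c] B
      by (intro L2_mult_bounded[OF gc_L2, of _ B]) (simp_all only: norm_of_real, simp add: L2_def)
    then show ?thesis by (simp add: power_divide)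
  qed
  have vw: "has_weak_deriv (\<lambda>x. of_real (?v x)) (\<lambda>x. complex_of_real (?k x))"
  proof (rule has_weak_deriv_piecewise[OF fin _ kL])
    show "continuous_on I_int (\<lambda>x. complex_of_real (?v x))"
      by (intro continuous_on_of_real continuous_on_subset[OF vc I_sub])
    show "((\<lambda>x. complex_of_real (?v x)) has_vector_derivative of_real (?k x)) (at x)" if x: "x \<in> I_int - Y" for x
    proof -
      have "(u has_real_derivative g x) (at x)" using u_deriv x by (auto simp: I_int_def)
      moreover have "u x \<noteq> 0" using u0 I_sub x by blast
      ultimately have "(?v has_real_derivative ?k x) (at x)"
        by (auto intro!: derivative_eq_intros simp: power2_eq_square)
      then show ?thesis by (intro has_vector_derivative_of_real)
    qed
  qed
  note wc = has_weak_deriv_cnj[OF w]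
  let ?t = "\<lambda>x. \<phi> x * cnj (\<phi> x) * of_real (?v x)"
  let ?t' = "\<lambda>x. (h x * cnj (\<phi> x) + \<phi> x * cnj (h x)) * of_real (?v x) + \<phi> x * cnj (\<phi> x) * of_real (?k x)"
  have tw: "has_weak_deriv ?t ?t'"
    by (rule has_weak_deriv_mult[OF has_weak_deriv_mult[OF w wc] vw])
  have tl: "(?t \<longlongrightarrow> l * cnj l * of_real (?v 0)) (at_right 0)"
    "(?t \<longlongrightarrow> l * cnj l * of_real (?v 0)) (at_left (2*pi))"
  proof -
    show "(?t \<longlongrightarrow> l * cnj l * of_real (?v 0)) (at_right 0)"
      by (intro tendsto_mult l tendsto_cnj ends(1)[OF vc])
    have "(?t \<longlongrightarrow> l * cnj l * of_real (?v (2*pi))) (at_left (2*pi))"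
      by (intro tendsto_mult l tendsto_cnj ends(2)[OF vc])
    then show "(?t \<longlongrightarrow> l * cnj l * of_real (?v 0)) (at_left (2*pi))" using u_per by simp
  qed
  have tu: "?t x * uc x = of_real ((cmod (\<phi> x))\<^sup>2)" if "x \<in> {0..2*pi}" for x
    using u0[OF that] by (simp add: complex_norm_square[symmetric] flip: of_real_power of_real_mult of_real_divide)
  have "(LINT x:I_int|lborel. ?t x * uc x) = (LINT x:I_int|lborel. complex_of_real ((cmod (\<phi> x))\<^sup>2))"
    by (intro set_lebesgue_integral_cong allI impI tu) (use I_sub in auto)
  also have "\<dots> = of_real (LINT x:I_int|lborel. (cmod (\<phi> x))\<^sup>2)"
    by (rule set_integral_complex_of_real)
  finally have e1: "(LINT x:I_int|lborel. ?t x * uc x) = of_real (LINT x:I_int|lborel. (cmod (\<phi> x))\<^sup>2)" .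
  have e2: "(\<Sum>y\<in>Y. ?t y * uc y) = of_real (\<Sum>y\<in>Y. (cmod (\<phi> y))\<^sup>2)"
    unfolding of_real_sum using sub by (intro sum.cong refl tu) auto
  have W: "(LINT x:I_int|lborel. ?t' x * gc x) + of_real \<alpha> * of_real (\<Sum>y\<in>Y. (cmod (\<phi> y))\<^sup>2)
    = of_real \<kappa> * of_real (LINT x:I_int|lborel. (cmod (\<phi> x))\<^sup>2)"
    using weak_form[OF tw tl] unfolding e1 e2 .
  have t'L: "?t' \<in> L2" using tw by (simp add: has_weak_deriv_def)
  let ?r = "\<lambda>x. Re (?t' x * gc x)"
  have ii: "set_integrable lborel I_int (\<lambda>x. ?t' x * gc x)"
    by (rule L2_mult_integrable[OF t'L gc_L2])
  have ri: "set_integrable lborel I_int ?r"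
    using integrable_Re[OF ii[unfolded set_integrable_def]]
    unfolding set_integrable_def by (simp only: scaleR_complex.sel real_scaleR_def)
  have rr: "Re (LINT x:I_int|lborel. ?t' x * gc x) = (LINT x:I_int|lborel. ?r x)"
    using integral_Re[OF ii[unfolded set_integrable_def]]
    unfolding set_lebesgue_integral_def by (simp only: scaleR_complex.sel real_scaleR_def)
  have "(LINT x:I_int|lborel. ?r x) \<le> (LINT x:I_int|lborel. (cmod (h x))\<^sup>2)"
  proof (rule set_integral_mono[OF ri])
    show "set_integrable lborel I_int (\<lambda>x. (cmod (h x))\<^sup>2)" using hL by (simp add: L2_def)
    fix x assume "x \<in> I_int"
    then have ux: "u x \<noteq> 0" using u0 I_sub by blast
    \<comment> \<open>The defect in Picone's identity is the square of \<phi>' - \<phi>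
      u'/u.\<close>
    have "(cmod (h x))\<^sup>2 - ?r x = (cmod (h x - \<phi> x * of_real (g x / u x)))\<^sup>2"
      using ux unfolding cmod_power2
      by (simp add: field_simps power2_eq_square)
    then show "?r x \<le> (cmod (h x))\<^sup>2"
      by (metis diff_ge_0_iff_ge zero_le_power2)
  qed
  moreover have "Re (LINT x:I_int|lborel. ?t' x * gc x) + \<alpha> * (\<Sum>y\<in>Y. (cmod (\<phi> y))\<^sup>2)
    = \<kappa> * (LINT x:I_int|lborel. (cmod (\<phi> x))\<^sup>2)"
    using arg_cong[OF W, of Re] by (simp only: plus_complex.sel Re_complex_of_real flip: of_real_mult)
  ultimately show ?thesis using rr by linarith
qed

text \<open>An eigenfunction for \<mu> tested with itself has form value \<mu> times its squared
  norm, and \<open>lower_bound\<close> compares this with \<kappa>.\<close>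

theorem lambda1_eq: "lambda1 \<alpha> Y = \<kappa>"
  unfolding lambda1_def
proof (rule Least_equality[of "\<lambda>\<mu>. is_eigenvalue \<alpha> Y (of_real \<mu>)", OF eigenvalue])
  fix \<mu> :: real
  assume "is_eigenvalue \<alpha> Y (of_real \<mu>)"
  then obtain \<psi> where nz: "\<not> (AE x\<in>I_int in lborel. \<psi> x = 0)"
    and H: "H_op \<alpha> Y \<psi> (\<lambda>x. of_real \<mu> * \<psi> x)"
    by (auto simp: is_eigenvalue_def)
  then have fd: "\<psi> \<in> form_dom" and q: "q_form \<alpha> Y \<psi> \<psi> = L2_inner \<psi> (\<lambda>x. of_real \<mu> * \<psi> x)"
    by (auto simp: H_op_def)
  then obtain l where p: "\<psi> \<in> H1" and l: "(\<psi> \<longlongrightarrow> l) (at_right 0)" "(\<psi> \<longlongrightarrow> l) (at_left (2*pi))"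
    by (auto simp: form_dom_def)
  note w = has_weak_deriv_weak_deriv[OF p]
  let ?n = "LINT x:I_int|lborel. (cmod (\<psi> x))\<^sup>2"
  have "L2_inner \<psi> (\<lambda>x. of_real \<mu> * \<psi> x) = of_real \<mu> * L2_inner \<psi> \<psi>"
    unfolding L2_inner_def by (simp add: mult.left_commute)
  then have "L2_inner \<psi> (\<lambda>x. of_real \<mu> * \<psi> x) = of_real (\<mu> * ?n)"
    by (simp add: L2_inner_self)
  moreover have "q_form \<alpha> Y \<psi> \<psi>
    = of_real ((LINT x:I_int|lborel. (cmod (weak_deriv \<psi> x))\<^sup>2) + \<alpha> * (\<Sum>y\<in>Y. (cmod (\<psi> y))\<^sup>2))"
  proof -
    have "(\<Sum>y\<in>Y. cnj (\<psi> y) * \<psi> y) = of_real (\<Sum>y\<in>Y. (cmod (\<psi> y))\<^sup>2)"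
      unfolding of_real_sum by (intro sum.cong refl) (metis complex_norm_square mult.commute)
    then show ?thesis unfolding q_form_def L2_inner_self by simp
  qed
  ultimately have "(LINT x:I_int|lborel. (cmod (weak_deriv \<psi> x))\<^sup>2) + \<alpha> * (\<Sum>y\<in>Y. (cmod (\<psi> y))\<^sup>2) = \<mu> * ?n"
    using q by (metis of_real_eq_iff)
  with lower_bound[OF w l] have "\<kappa> * ?n \<le> \<mu> * ?n" by simp
  moreover have "0 < ?n"
    by (rule L2_norm_pos[OF has_weak_deriv_L2[OF w] nz])
  ultimately show "\<kappa> \<le> \<mu>" by simp
qed

end

section \<open>Solutions of the free equation\<close>

text \<open>The fundamental solutions of \<open>- w'' = \<kappa> w\<close>.\<close>

definition gcos :: "real \<Rightarrow> real \<Rightarrow> real" where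
  "gcos \<kappa> x = (if \<kappa> \<ge> 0 then cos (sqrt \<kappa> * x) else cosh (sqrt (- \<kappa>) * x))"

definition gsin :: "real \<Rightarrow> real \<Rightarrow> real" where
  "gsin \<kappa> x = (if \<kappa> > 0 then sin (sqrt \<kappa> * x) / sqrt \<kappa>
     else if \<kappa> = 0 then x else sinh (sqrt (- \<kappa>) * x) / sqrt (- \<kappa>))"

lemma gcos_0 [simp]: "gcos \<kappa> 0 = 1" and gsin_0 [simp]: "gsin \<kappa> 0 = 0"
  by (simp_all add: gcos_def gsin_def)

lemma gcos_minus [simp]: "gcos \<kappa> (- x) = gcos \<kappa> x"
  by (simp add: gcos_def)

lemma gsin_has_derivative: "(gsin \<kappa> has_real_derivative gcos \<kappa> x) (at x)"
  and gcos_has_derivative: "(gcos \<kappa> has_real_derivative - \<kappa> * gsin \<kappa> x) (at x)"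
proof -
  have "(gsin \<kappa> has_real_derivative gcos \<kappa> x) (at x) \<and> (gcos \<kappa> has_real_derivative - \<kappa> * gsin \<kappa> x) (at x)"
  proof (cases \<kappa> "0::real" rule: linorder_cases)
    case less
    define k where "k = sqrt (- \<kappa>)"
    have k: "0 < k" "\<kappa> = - (k * k)" "sqrt (- \<kappa>) = k" using less by (auto simp: k_def)
    have "((\<lambda>x. sinh (k * x) / k) has_real_derivative cosh (k * x)) (at x)"
      "((\<lambda>x. cosh (k * x)) has_real_derivative - \<kappa> * (sinh (k * x) / k)) (at x)"
      using k(1) by (auto intro!: derivative_eq_intros simp: k(2))
    moreover have "gsin \<kappa> = (\<lambda>x. sinh (k * x) / k)" "gcos \<kappa> = (\<lambda>x. cosh (k * x))"
      using less by (auto simp: fun_eq_iff gsin_def gcos_def k(3))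
    ultimately show ?thesis by simp
  next
    case greater
    define k where "k = sqrt \<kappa>"
    have k: "0 < k" "\<kappa> = k * k" "sqrt \<kappa> = k" using greater by (auto simp: k_def)
    have "((\<lambda>x. sin (k * x) / k) has_real_derivative cos (k * x)) (at x)"
      "((\<lambda>x. cos (k * x)) has_real_derivative - (k * k) * (sin (k * x) / k)) (at x)"
      using k(1) by (auto intro!: derivative_eq_intros)
    then show ?thesis using greater k(2,3) by (simp add: gsin_def[abs_def] gcos_def[abs_def])
  qed (auto simp: gsin_def[abs_def] gcos_def[abs_def])
  then show "(gsin \<kappa> has_real_derivative gcos \<kappa> x) (at x)"
    and "(gcos \<kappa> has_real_derivative - \<kappa> * gsin \<kappa> x) (at x)" by auto
qed

lemma gcos_gsin_square: "(gcos \<kappa> x)\<^sup>2 + \<kappa> * (gsin \<kappa> x)\<^sup>2 = 1"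
  by (cases \<kappa> "0::real" rule: linorder_cases)
    (auto simp: gcos_def gsin_def power_divide cosh_square_eq)

lemma gsin_add: "gsin \<kappa> (a + b) = gsin \<kappa> a * gcos \<kappa> b + gcos \<kappa> a * gsin \<kappa> b"
  by (cases \<kappa> "0::real" rule: linorder_cases)
    (auto simp: gcos_def gsin_def sin_add sinh_add distrib_left add_divide_distrib)

lemma gcos_add: "gcos \<kappa> (a + b) = gcos \<kappa> a * gcos \<kappa> b - \<kappa> * gsin \<kappa> a * gsin \<kappa> b"
  by (cases \<kappa> "0::real" rule: linorder_cases)
    (auto simp: gcos_def gsin_def cos_add cosh_add distrib_left)

lemma continuous_gcos: "continuous_on UNIV (\<lambda>\<kappa>. gcos \<kappa> x)"
proof -
  \<comment> \<open>For each sign of \<kappa> one of the two factors is 1, so the case distinction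
    becomes a product of continuous functions.\<close>
  have "(\<lambda>\<kappa>. gcos \<kappa> x) = (\<lambda>\<kappa>. cos (sqrt (max \<kappa> 0) * x) * cosh (sqrt (max (- \<kappa>) 0) * x))"
    by (auto simp: gcos_def max_def)
  then show ?thesis by (simp only:) (intro continuous_intros)
qed

text \<open>The critical point is \<kappa> = 0, where sin (t x) / t and sinh (t x) / t both tend to
  x, being difference quotients at t = 0; the two signs of \<kappa> give the two one-sided
  limits.\<close>

lemma continuous_gsin: "continuous_on UNIV (\<lambda>\<kappa>. gsin \<kappa> x)"
proof -
  have "isCont (\<lambda>\<kappa>. gsin \<kappa> x) \<kappa>" for \<kappa>
  proof (cases \<kappa> "0::real" rule: linorder_cases)
    case less
    have "continuous_on {..<0} (\<lambda>\<kappa>. sinh (sqrt (- \<kappa>) * x) / sqrt (- \<kappa>))"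
      by (auto intro!: continuous_intros)
    then have "continuous_on {..<0} (\<lambda>\<kappa>. gsin \<kappa> x)"
      by (rule continuous_on_eq) (auto simp: gsin_def)
    then show ?thesis using less by (simp add: continuous_on_eq_continuous_at)
  next
    case greater
    have "continuous_on {0<..} (\<lambda>\<kappa>. sin (sqrt \<kappa> * x) / sqrt \<kappa>)"
      by (auto intro!: continuous_intros)
    then have "continuous_on {0<..} (\<lambda>\<kappa>. gsin \<kappa> x)"
      by (rule continuous_on_eq) (auto simp: gsin_def)
    then show ?thesis using greater by (simp add: continuous_on_eq_continuous_at)
  next
    case equal
    have s: "((\<lambda>t. sin (t * x) / t) \<longlongrightarrow> x) (at 0)" "((\<lambda>t. sinh (t * x) / t) \<longlongrightarrow> x) (at 0)"
      using DERIV_def[of "\<lambda>t. sin (t * x)" x 0] DERIV_def[of "\<lambda>t. sinh (t * x)" x 0]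
      by (auto intro!: derivative_eq_intros)
    have "filterlim sqrt (at 0) (at_right 0)" "filterlim (\<lambda>t. sqrt (- t)) (at 0) (at_left 0)"
      unfolding filterlim_at by (auto intro!: tendsto_eq_intros simp: eventually_at_filter)
    from filterlim_compose[OF s(1) this(1)] filterlim_compose[OF s(2) this(2)] have "((\<lambda>\<kappa>. gsin \<kappa> x) \<longlongrightarrow> x) (at_right 0)" "((\<lambda>\<kappa>. gsin \<kappa> x) \<longlongrightarrow> x) (at_left 0)"
      by (auto elim!: Lim_transform_eventually
          simp: gsin_def eventually_at_filter)
    then show ?thesis using equal by (simp add: isCont_def filterlim_split_at_real gsin_def)
  qed
  then show ?thesis by (simp add: continuous_at_imp_continuous_on)
qed

lemma sqrt_times_le:
  assumes "\<bar>\<kappa>\<bar> \<le> 1/16" "0 \<le> x" "x \<le> 2 * pi" "0 \<le> \<kappa>"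
  shows "sqrt \<kappa> * x \<le> pi / 2"
proof -
  have "sqrt \<kappa> \<le> sqrt ((1/4)\<^sup>2)" using assms by (intro real_sqrt_le_mono) (simp add: power2_eq_square)
  then have "sqrt \<kappa> \<le> 1/4" by simp
  then have "sqrt \<kappa> * x \<le> 1/4 * (2 * pi)" using assms by (intro mult_mono) auto
  then show ?thesis by simp
qed

lemma gsin_pos:
  assumes "\<bar>\<kappa>\<bar> \<le> 1/16" "0 < x" "x \<le> 2 * pi"
  shows "0 < gsin \<kappa> x"
proof (cases "0 < \<kappa>")
  case True
  then have "sqrt \<kappa> * x \<le> pi/2" "0 < sqrt \<kappa> * x" using sqrt_times_le[of \<kappa> x] assms by auto
  then have "0 < sin (sqrt \<kappa> * x)" by (intro sin_gt_zero) auto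
  then show ?thesis using True by (simp add: gsin_def)
qed (use assms in \<open>auto simp: gsin_def\<close>)

lemma gcos_nonneg:
  assumes "\<bar>\<kappa>\<bar> \<le> 1/16" "0 \<le> x" "x \<le> 2 * pi"
  shows "0 \<le> gcos \<kappa> x"
proof (cases "0 \<le> \<kappa>")
  case True
  then have "sqrt \<kappa> * x \<le> pi/2" "0 \<le> sqrt \<kappa> * x" using sqrt_times_le[of \<kappa> x] assms by auto
  then show ?thesis using True by (auto simp: gcos_def intro!: cos_ge_zero)
qed (simp add: gcos_def cosh_real_nonneg)

lemma gcos_pos:
  assumes "\<bar>\<kappa>\<bar> \<le> 1/16" "\<bar>x\<bar> \<le> pi"
  shows "0 < gcos \<kappa> x"
proof -
  have "0 < gcos \<kappa> \<bar>x\<bar>"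
  proof (cases "0 \<le> \<kappa>")
    case True
    \<comment> \<open>Applying the angle bound to twice the argument leaves an angle of at most
      pi/4, hence a strictly positive cosine.\<close>
    then have "sqrt \<kappa> * (2 * \<bar>x\<bar>) \<le> pi/2" "0 \<le> sqrt \<kappa> * \<bar>x\<bar>"
      using sqrt_times_le[of \<kappa> "2 * \<bar>x\<bar>"] assms by auto
    moreover have "sqrt \<kappa> * (2 * \<bar>x\<bar>) = 2 * (sqrt \<kappa> * \<bar>x\<bar>)" by simp
    ultimately have "- (pi / 2) < sqrt \<kappa> * \<bar>x\<bar>" "sqrt \<kappa> * \<bar>x\<bar> < pi / 2" using pi_gt_zero by linarith+
    then show ?thesis using True by (simp add: gcos_def cos_gt_zero_pi)
  qed (simp add: gcos_def cosh_real_pos)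
  then show ?thesis by (cases "0 \<le> x") (auto simp: abs_if)
qed

text \<open>\<open>gtan \<kappa> x\<close> is \<open>k tan (k x / 2)\<close> for \<open>\<kappa> = k\<^sup>2\<close> and \<open>- k tanh (k x / 2)\<close> for \<open>\<kappa> = - k\<^sup>2\<close>.\<close>

definition gtan :: "real \<Rightarrow> real \<Rightarrow> real" where
  "gtan \<kappa> x = \<kappa> * gsin \<kappa> x / (1 + gcos \<kappa> x)"

text \<open>The two half-angle formulas: the one in the definition is regular at x = 0, the one here
  is what \<open>edge_form\<close> produces.\<close>

lemma gtan_eq:
  assumes "\<bar>\<kappa>\<bar> \<le> 1/16" "0 < x" "x \<le> 2 * pi"
  shows "gtan \<kappa> x = (1 - gcos \<kappa> x) / gsin \<kappa> x"
proof -
  have "0 < gsin \<kappa> x" "0 \<le> gcos \<kappa> x" using gsin_pos gcos_nonneg assms by auto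
  then show ?thesis using gcos_gsin_square[of \<kappa> x]
    by (simp add: gtan_def frac_eq_eq power2_eq_square algebra_simps)
qed

lemma gtan_sgn:
  assumes "\<bar>\<kappa>\<bar> \<le> 1/16" "0 < x" "x \<le> 2 * pi"
  shows "0 < \<kappa> \<Longrightarrow> 0 < gtan \<kappa> x" "\<kappa> < 0 \<Longrightarrow> gtan \<kappa> x < 0"
  using gsin_pos[OF assms] gcos_nonneg[of \<kappa> x] assms
  by (auto simp: gtan_def zero_less_mult_iff mult_less_0_iff divide_less_0_iff)

lemma continuous_gtan:
  assumes "0 \<le> x" "x \<le> 2 * pi"
  shows "continuous_on {-1/16..1/16} (\<lambda>\<kappa>. gtan \<kappa> x)"
proof -
  have "1 + gcos \<kappa> x \<noteq> 0" if "\<kappa> \<in> {-1/16..1/16}" for \<kappa>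
  proof -
    have "\<bar>\<kappa>\<bar> \<le> 1/16" using that by auto
    from gcos_nonneg[OF this assms] show ?thesis by simp
  qed
  then show ?thesis unfolding gtan_def
    by (intro continuous_intros continuous_on_subset[OF continuous_gcos] continuous_on_subset[OF continuous_gsin]) auto
qed

lemma gtan_has_derivative:
  assumes "\<bar>\<kappa>\<bar> \<le> 1/16" "0 \<le> x" "x \<le> 2 * pi"
  shows "(gtan \<kappa> has_real_derivative \<kappa> / (1 + gcos \<kappa> x)) (at x)"
proof -
  have p: "0 \<le> gcos \<kappa> x" using gcos_nonneg assms by auto
  then have n: "1 + gcos \<kappa> x \<noteq> 0" by simp
  have "(gtan \<kappa> has_real_derivative (\<kappa> * gcos \<kappa> x * (1 + gcos \<kappa> x) - \<kappa> * gsin \<kappa> x * (- \<kappa> * gsin \<kappa> x))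
      / ((1 + gcos \<kappa> x) * (1 + gcos \<kappa> x))) (at x)"
    unfolding gtan_def[abs_def]
    using n by (auto intro!: derivative_eq_intros gcos_has_derivative gsin_has_derivative)
  also have "\<kappa> * gcos \<kappa> x * (1 + gcos \<kappa> x) - \<kappa> * gsin \<kappa> x * (- \<kappa> * gsin \<kappa> x) = \<kappa> * (1 + gcos \<kappa> x)"
    using gcos_gsin_square[of \<kappa> x] by algebra
  finally show ?thesis using n by simp
qed

text \<open>Strict convexity of \<open>gtan \<kappa>\<close>: the second derivative is \<kappa>
  squared times gsin / (1 + gcos)^2, hence positive for both signs of \<kappa>.\<close>

lemma gtan_deriv_less:
  assumes "\<bar>\<kappa>\<bar> \<le> 1/16" "\<kappa> \<noteq> 0" "0 \<le> a" "a < b" "b \<le> 2 * pi"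
  shows "\<kappa> / (1 + gcos \<kappa> a) < \<kappa> / (1 + gcos \<kappa> b)"
proof (rule DERIV_pos_imp_increasing_open[OF \<open>a < b\<close>])
  have nz: "1 + gcos \<kappa> x \<noteq> 0" if "a \<le> x" "x \<le> b" for x using gcos_nonneg[of \<kappa> x] assms that by auto
  have d: "((\<lambda>x. \<kappa> / (1 + gcos \<kappa> x)) has_real_derivative \<kappa>\<^sup>2 * gsin \<kappa> x / (1 + gcos \<kappa> x)\<^sup>2) (at x)"
    if "a \<le> x" "x \<le> b" for x
    using nz[OF that] by (auto intro!: derivative_eq_intros gcos_has_derivative simp: power2_eq_square)
  fix x assume x: "a < x" "x < b"
  then have "0 < gsin \<kappa> x" using assms by (intro gsin_pos) auto
  then have "0 < \<kappa>\<^sup>2 * gsin \<kappa> x / (1 + gcos \<kappa> x)\<^sup>2"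
    using nz[of x] x assms(2) by (auto intro!: divide_pos_pos mult_pos_pos)
  then show "\<exists>y. ((\<lambda>x. \<kappa> / (1 + gcos \<kappa> x)) has_real_derivative y) (at x) \<and> 0 < y"
    using d[of x] x by auto
next
  have "1 + gcos \<kappa> x \<noteq> 0" if "x \<in> {a..b}" for x using gcos_nonneg[of \<kappa> x] assms that by auto
  moreover have "continuous_on {a..b} (gcos \<kappa>)"
    using gcos_has_derivative DERIV_isCont continuous_at_imp_continuous_on by blast
  ultimately show "continuous_on {a..b} (\<lambda>x. \<kappa> / (1 + gcos \<kappa> x))"
    by (intro continuous_intros) auto
qed

text \<open>A strictly convex function lies above its tangents, by the mean value theorem on either
  side of a. The tangent form is convenient because linear terms cancel when summed over the
  arcs.\<close>

lemma gtan_tangent_strict: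
  assumes k: "\<bar>\<kappa>\<bar> \<le> 1/16" "\<kappa> \<noteq> 0" and x: "0 \<le> x" "x \<le> 2 * pi" and a: "0 \<le> a" "a \<le> 2 * pi" "x \<noteq> a"
  shows "gtan \<kappa> a + \<kappa> / (1 + gcos \<kappa> a) * (x - a) < gtan \<kappa> x"
proof (cases "a < x")
  case True
  then obtain z where z: "a < z" "z < x" "gtan \<kappa> x - gtan \<kappa> a = (x - a) * (\<kappa> / (1 + gcos \<kappa> z))"
    using MVT2[of a x "gtan \<kappa>" "\<lambda>z. \<kappa> / (1 + gcos \<kappa> z)"] gtan_has_derivative k x a by force
  have "\<kappa> / (1 + gcos \<kappa> a) < \<kappa> / (1 + gcos \<kappa> z)" using z k x a by (intro gtan_deriv_less) auto
  then have "(x - a) * (\<kappa> / (1 + gcos \<kappa> a)) < (x - a) * (\<kappa> / (1 + gcos \<kappa> z))"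
    using True by (intro mult_strict_left_mono) auto
  then show ?thesis using z(3) by (simp add: mult.commute)
next
  case False
  then have "x < a" using a by simp
  then obtain z where z: "x < z" "z < a" "gtan \<kappa> a - gtan \<kappa> x = (a - x) * (\<kappa> / (1 + gcos \<kappa> z))"
    using MVT2[of x a "gtan \<kappa>" "\<lambda>z. \<kappa> / (1 + gcos \<kappa> z)"] gtan_has_derivative k x a by force
  have "\<kappa> / (1 + gcos \<kappa> z) < \<kappa> / (1 + gcos \<kappa> a)" using z k x a by (intro gtan_deriv_less) auto
  then have "(a - x) * (\<kappa> / (1 + gcos \<kappa> z)) < (a - x) * (\<kappa> / (1 + gcos \<kappa> a))"
    using \<open>x < a\<close> by (intro mult_strict_left_mono) auto
  moreover have "\<kappa> / (1 + gcos \<kappa> a) * (x - a) = - ((a - x) * (\<kappa> / (1 + gcos \<kappa> a)))"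
    by (metis minus_diff_eq minus_mult_left mult.commute)
  ultimately show ?thesis using z(3) by linarith
qed

lemma gtan_tangent:
  assumes "\<bar>\<kappa>\<bar> \<le> 1/16" "0 \<le> x" "x \<le> 2 * pi" "0 \<le> a" "a \<le> 2 * pi"
  shows "gtan \<kappa> a + \<kappa> / (1 + gcos \<kappa> a) * (x - a) \<le> gtan \<kappa> x"
proof (cases "x = a \<or> \<kappa> = 0")
  case True then show ?thesis by (auto simp: gtan_def)
next
  case False then show ?thesis using gtan_tangent_strict[of \<kappa> x a] assms by auto
qed

section \<open>Piecewise solutions on the loop\<close>

text \<open>Off the kink at c the function is locally either f or constant.\<close>

lemma DERIV_max_right:
  fixes f :: "real \<Rightarrow> real"
  assumes "(f has_real_derivative D) (at x)" "x \<noteq> c"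
  shows "((\<lambda>x. f (max x c)) has_real_derivative (if c \<le> x then D else 0)) (at x)"
proof (cases "c < x")
  case True
  then have "eventually (\<lambda>t. f t = f (max t c)) (nhds x)"
    by (intro eventually_mono[OF eventually_nhds_in_open[of "{c<..}"]]) auto
  then show ?thesis using assms(1) True DERIV_cong_ev[OF refl _ refl] by fastforce
next
  case False
  then have "x < c" using assms by simp
  then have "eventually (\<lambda>t. f (max t c) = f c) (nhds x)"
    by (intro eventually_mono[OF eventually_nhds_in_open[of "{..<c}"]]) auto
  then have "((\<lambda>x. f (max x c)) has_real_derivative 0) (at x) \<longleftrightarrow> ((\<lambda>x. f c) has_real_derivative 0) (at x)"
    by (intro DERIV_cong_ev) auto
  then show ?thesis using \<open>x < c\<close> by simp
qed

locale loop_partition =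
  fixes N :: nat and z :: "nat \<Rightarrow> real"
  assumes z_0: "z 0 = 0" and z_end: "z (Suc N) = 2 * pi"
    and z_less: "\<And>i. i \<le> N \<Longrightarrow> z i < z (Suc i)"
begin

abbreviation pts :: "real set" where "pts \<equiv> z ` {1..N}"

lemma z_mono_less: "j \<le> Suc N \<Longrightarrow> i < j \<Longrightarrow> z i < z j"
proof (induction j)
  case (Suc j)
  then show ?case using z_less[of j] by (cases "i = j") auto
qed simp

lemma z_mono: "j \<le> Suc N \<Longrightarrow> i \<le> j \<Longrightarrow> z i \<le> z j"
  using z_mono_less[of j i] by (cases "i = j") auto

lemma z_inj: "inj_on z {1..N}"
proof (rule inj_onI)
  fix i j assume "i \<in> {1..N}" "j \<in> {1..N}" "z i = z j"
  then show "i = j" using z_mono_less[of i j] z_mono_less[of j i] by (cases i j rule: linorder_cases) auto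
qed

lemma pts_sub: "pts \<subseteq> {0<..<2*pi}"
  using z_mono_less[of _ 0] z_mono_less[of "Suc N"] z_0 z_end by (force simp: image_subset_iff)

lemma obtain_piece:
  assumes "x \<in> {0..2*pi}"
  obtains i where "i \<le> N" "z i \<le> x" "x \<le> z (Suc i)"
proof -
  have "\<exists>i\<le>N. z i \<le> x \<and> x \<le> z (Suc i)" if "x \<le> z (Suc n)" "n \<le> N" for n
    using that
  proof (induction n)
    case 0 then show ?case using assms z_0 by auto
  next
    case (Suc n)
    then show ?case by (cases "x \<le> z (Suc n)") (auto intro!: exI[of _ "Suc n"])
  qed
  from this[of N] show thesis using assms z_end that by auto
qed

text \<open>At a point of piece i the changes h j made at later nodes vanish and those at earlier
  nodes telescope to piece i. It serves both the solution, glued with \<open>max\<close>, and its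
  derivative, glued with \<open>if\<close>.\<close>

lemma glue_telescope:
  fixes f :: "nat \<Rightarrow> 'a::ab_group_add"
  assumes "i \<le> N" "z i \<le> x" "\<And>j. j \<in> {1..N} \<Longrightarrow> i < j \<Longrightarrow> h j = 0"
    and "\<And>j. j \<in> {1..N} \<Longrightarrow> j \<le> i \<Longrightarrow> h j = f j - f (j - 1)"
  shows "f 0 + (\<Sum>j\<in>{1..N}. h j) = f i"
proof -
  have "(\<Sum>j\<in>{1..N}. h j) = (\<Sum>j\<in>{1..i}. f j - f (j - 1))"
    using assms by (intro sum.mono_neutral_cong_right) auto
  also have "\<dots> = f i - f 0"
    using sum_telescope''[of 0 i f] by simp
  finally show ?thesis by simp
qed

text \<open>A function that solves the eigenvalue equation piecewise is assembled without case distinctions: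
  the difference of two consecutive pieces vanishes at their common node, so
  \<open>x \<mapsto> d (max x (z j))\<close> adds the change at \<open>z j\<close> as a continuous function.\<close>

lemma ground_state_of_pieces:
  fixes p p' :: "nat \<Rightarrow> real \<Rightarrow> real"
  assumes p: "\<And>i x. i \<le> N \<Longrightarrow> (p i has_real_derivative p' i x) (at x)"
    and p': "\<And>i x. i \<le> N \<Longrightarrow> (p' i has_real_derivative - \<kappa> * p i x) (at x)"
    and pos: "\<And>i x. i \<le> N \<Longrightarrow> z i \<le> x \<Longrightarrow> x \<le> z (Suc i) \<Longrightarrow> 0 < p i x"
    and cont: "\<And>i. i < N \<Longrightarrow> p i (z (Suc i)) = p (Suc i) (z (Suc i))"
    and jump: "\<And>i. i < N \<Longrightarrow> p' (Suc i) (z (Suc i)) - p' i (z (Suc i)) = \<alpha> * p (Suc i) (z (Suc i))"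
    and per: "p N (2*pi) = p 0 0" "p' N (2*pi) = p' 0 0"
  shows "lambda1 \<alpha> pts = \<kappa>"
proof -
  define d where "d j x = p j x - p (j - 1) x" for j x
  define d' where "d' j x = p' j x - p' (j - 1) x" for j x
  define u where "u x = p 0 x + (\<Sum>j\<in>{1..N}. d j (max x (z j)))" for x
  define g where "g x = p' 0 x + (\<Sum>j\<in>{1..N}. if z j \<le> x then d' j x else 0)" for x
  have dz: "d j (z j) = 0" and d'z: "d' j (z j) = \<alpha> * p j (z j)" if "j \<in> {1..N}" for j
    using cont[of "j - 1"] jump[of "j - 1"] that by (auto simp: d_def d'_def)
  have dd: "(d j has_real_derivative d' j x) (at x)"
    and dd': "(d' j has_real_derivative - \<kappa> * d j x) (at x)" if "j \<in> {1..N}" for j x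
    unfolding d_def[abs_def] d'_def[abs_def] using that
    by (auto intro!: derivative_eq_intros p p' simp: algebra_simps)
  have u_piece: "u x = p i x" if "i \<le> N" "z i \<le> x" "x \<le> z (Suc i)" for i x
    unfolding u_def
  proof (rule glue_telescope[OF that(1,2), where f="\<lambda>i. p i x"])
    fix j assume j: "j \<in> {1..N}"
    show "d j (max x (z j)) = 0" if "i < j"
    proof -
      have "x \<le> z j" using z_mono[of j "Suc i"] that j \<open>x \<le> z (Suc i)\<close> by auto
      then show ?thesis using dz[OF j] by (simp add: max_def)
    qed
    show "d j (max x (z j)) = p j x - p (j - 1) x" if "j \<le> i"
      using z_mono[of i j] that j \<open>z i \<le> x\<close> \<open>i \<le> N\<close>
      by (cases "x = z j") (auto simp: max_def d_def)
  qed
  have uz: "u (z j) = p j (z j)" if "j \<in> {1..N}" for j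
    using u_piece[of j "z j"] z_less[of j] that by auto
  have g0: "g 0 = p' 0 0"
  proof -
    have "\<not> z j \<le> 0" if "j \<in> {1..N}" for j using z_mono_less[of j 0] z_0 that by auto
    then show ?thesis by (simp add: g_def)
  qed
  have "p' 0 (2*pi) + (\<Sum>j\<in>{1..N}. if z j \<le> 2*pi then d' j (2*pi) else 0) = p' N (2*pi)"
    by (rule glue_telescope[of N "2*pi"]) (use z_mono[of "Suc N"] z_end in \<open>auto simp: d'_def\<close>)
  then have gN: "g (2*pi) = g 0" using g0 per by (simp add: g_def)
  \<comment> \<open>The flux in manifestly continuous form: by \<open>d'z\<close> each summand is 0
    to the left of its node and starts there from 0.\<close>
  define G where "G x = p' 0 x + (\<Sum>j\<in>{1..N}. d' j (max x (z j)) - \<alpha> * u (z j))" for x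
  have flux: "g x - (\<Sum>y\<in>pts. if y \<le> x then \<alpha> * u y else 0) = G x" for x
  proof -
    have "(\<Sum>y\<in>pts. if y \<le> x then \<alpha> * u y else 0) = (\<Sum>j\<in>{1..N}. if z j \<le> x then \<alpha> * u (z j) else 0)"
      by (subst sum.reindex[OF z_inj]) (simp add: o_def)
    then have "g x - (\<Sum>y\<in>pts. if y \<le> x then \<alpha> * u y else 0)
      = p' 0 x + (\<Sum>j\<in>{1..N}. (if z j \<le> x then d' j x else 0) - (if z j \<le> x then \<alpha> * u (z j) else 0))"
      by (simp add: g_def sum_subtractf)
    also have "\<dots> = G x"
      unfolding G_def by (intro arg_cong2[where f="(+)"] sum.cong refl) (auto simp: max_def d'z uz)
    finally show ?thesis .
  qed
  have cn: "continuous_on A f" if "\<And>x. (f has_real_derivative f' x) (at x)" for f f' :: "real \<Rightarrow> real" and A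
    using that DERIV_isCont continuous_at_imp_continuous_on by blast
  have cmax: "continuous_on A (\<lambda>x. f (max x c))" if "\<And>A. continuous_on A f" for f :: "real \<Rightarrow> real" and c A
    by (rule continuous_on_compose2[OF that[of UNIV]]) (auto intro!: continuous_intros)
  interpret ground_state pts \<alpha> \<kappa> u g
  proof
    show "finite pts" by simp
    show "pts \<subseteq> {0<..<2*pi}" by (rule pts_sub)
    show "continuous_on {0..2*pi} u"
      unfolding u_def using cn[OF p[of 0]] cn[OF dd] by (intro continuous_intros cmax) auto
    show "0 < u x" if x: "x \<in> {0..2*pi}" for x
      using obtain_piece[OF x] u_piece pos by metis
    show "u (2*pi) = u 0"
      using u_piece[of 0 0] u_piece[of N "2*pi"] z_less[of 0] z_less[of N] z_0 z_end per by simp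
    show "g (2*pi) = g 0" by (rule gN)
    show "continuous_on {0..2*pi} (\<lambda>x. g x - (\<Sum>y\<in>pts. if y \<le> x then \<alpha> * u y else 0))"
      unfolding flux G_def using cn[OF p'[of 0]] cn[OF dd'] by (intro continuous_intros cmax) auto
    fix x assume x: "x \<in> {0<..<2*pi} - pts"
    have m: "((\<lambda>x. d j (max x (z j))) has_real_derivative (if z j \<le> x then d' j x else 0)) (at x)"
      "((\<lambda>x. d' j (max x (z j))) has_real_derivative (if z j \<le> x then - \<kappa> * d j x else 0)) (at x)"
      if "j \<in> {1..N}" for j
      using x that by (intro DERIV_max_right dd dd'; force)+
    show "(u has_real_derivative g x) (at x)"
      unfolding u_def[abs_def] g_def using p[of 0] m
      by (intro derivative_eq_intros DERIV_sum) auto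
    have "(G has_real_derivative - \<kappa> * p 0 x + (\<Sum>j\<in>{1..N}. (if z j \<le> x then - \<kappa> * d j x else 0) - 0)) (at x)"
      unfolding G_def[abs_def] using p'[of 0] m
      by (intro DERIV_add DERIV_sum DERIV_diff DERIV_const) auto
    also have "- \<kappa> * p 0 x + (\<Sum>j\<in>{1..N}. (if z j \<le> x then - \<kappa> * d j x else 0) - 0) = - \<kappa> * u x"
      unfolding u_def distrib_left sum_distrib_left
      by (intro arg_cong2[where f="(+)"] sum.cong refl) (auto simp: max_def dz)
    finally show "((\<lambda>x. g x - (\<Sum>y\<in>pts. if y \<le> x then \<alpha> * u y else 0)) has_real_derivative - \<kappa> * u x) (at x)"
      unfolding flux .
  qed
  show ?thesis by (rule lambda1_eq)
qed

end

section \<open>Reduction to a quadratic form on the node values\<close>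

text \<open>The first-order condition at a minimum whose value is 0; it turns nonnegativity of
  \<open>Q\<close> around a null vector into vanishing of the polar form.\<close>

lemma quadratic_linear_coeff_zero:
  fixes b c :: real
  assumes "\<And>t. 0 \<le> 2 * t * b + t\<^sup>2 * c"
  shows "b = 0"
proof (rule ccontr)
  assume b: "b \<noteq> 0"
  \<comment> \<open>At t = - b / m the expression is b^2 (c - 2 m) / m^2, and this m makes it
    negative unless b = 0.\<close>
  let ?m = "\<bar>c\<bar> + 1"
  have e: "(2 * (- b / m) * b + (- b / m)\<^sup>2 * c) * m\<^sup>2 = b\<^sup>2 * (c - 2 * m)" if "m \<noteq> 0" for m
    using that by (simp add: field_simps power2_eq_square)
  have "0 \<le> (2 * (- b / ?m) * b + (- b / ?m)\<^sup>2 * c) * ?m\<^sup>2"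
    by (intro mult_nonneg_nonneg assms) auto
  also have "\<dots> = b\<^sup>2 * (c - 2 * ?m)"
    by (rule e) simp
  finally have "0 \<le> c - 2 * ?m" using b by (simp add: zero_le_mult_iff)
  then show False by (smt (verit))
qed

text \<open>The least value of \<open>\<integral> \<bar>w'\<bar>\<^sup>2 - \<kappa> \<bar>w\<bar>\<^sup>2\<close> on an interval of length \<open>l\<close> with boundary values \<open>a\<close>, \<open>b\<close>.\<close>

definition edge_form :: "real \<Rightarrow> real \<Rightarrow> real \<Rightarrow> real \<Rightarrow> real" where
  "edge_form \<kappa> l a b = (gcos \<kappa> l * (a\<^sup>2 + b\<^sup>2) - 2 * a * b) / gsin \<kappa> l"

text \<open>The coefficient of a * b is negative, so equal signs are favourable; as in
  Perron-Frobenius theory this yields a nonnegative null vector.\<close>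

lemma edge_form_abs_le:
  assumes "\<bar>\<kappa>\<bar> \<le> 1/16" "0 < l" "l \<le> 2 * pi"
  shows "edge_form \<kappa> l \<bar>a\<bar> \<bar>b\<bar> \<le> edge_form \<kappa> l a b"
proof -
  have "a * b \<le> \<bar>a\<bar> * \<bar>b\<bar>" by (metis abs_ge_self abs_mult)
  then show ?thesis unfolding edge_form_def
    using gsin_pos[OF assms] by (intro divide_right_mono) auto
qed

text \<open>- gtan \<kappa> l is the smaller eigenvalue of the edge form, with eigenvector (1,
  1).\<close>

lemma edge_form_ge:
  assumes "\<bar>\<kappa>\<bar> \<le> 1/16" "0 < l" "l \<le> 2 * pi"
  shows "- gtan \<kappa> l * (a\<^sup>2 + b\<^sup>2) \<le> edge_form \<kappa> l a b"
proof -
  have "- gtan \<kappa> l * (a\<^sup>2 + b\<^sup>2) = (gcos \<kappa> l * (a\<^sup>2 + b\<^sup>2) - (a\<^sup>2 + b\<^sup>2)) / gsin \<kappa> l"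
    unfolding gtan_eq[OF assms] using gsin_pos[OF assms] by (simp add: field_simps)
  also have "\<dots> \<le> edge_form \<kappa> l a b"
    unfolding edge_form_def
    using gsin_pos[OF assms] sum_squares_bound[of a b] by (intro divide_right_mono) auto
  finally show ?thesis .
qed

context loop_partition
begin

text \<open>The point \<open>z 0 = 0\<close>, where the loop is cut open, is a node without interaction; the node
  \<open>z (Suc N) = 2 \<pi>\<close> is the same point of the loop, hence the condition \<open>v (Suc N) = v 0\<close> below.\<close>

definition len :: "nat \<Rightarrow> real" where "len i = z (Suc i) - z i"

lemma len_bounds: "i \<le> N \<Longrightarrow> 0 < len i" "i \<le> N \<Longrightarrow> len i \<le> 2 * pi"
  using z_less[of i] z_mono[of "Suc N" "Suc i"] z_mono[of i 0] z_0 z_end by (auto simp: len_def)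

definition Q :: "real \<Rightarrow> real \<Rightarrow> (nat \<Rightarrow> real) \<Rightarrow> real" where
  "Q \<alpha> \<kappa> v = (\<Sum>i\<le>N. edge_form \<kappa> (len i) (v i) (v (Suc i))) + \<alpha> * (\<Sum>i\<in>{1..N}. (v i)\<^sup>2)"

text \<open>The derivatives at the left and right end of the solution on the \<open>i\<close>-th interval
  with boundary values \<open>v i\<close> and \<open>v (Suc i)\<close>.\<close>

definition slope_l :: "real \<Rightarrow> (nat \<Rightarrow> real) \<Rightarrow> nat \<Rightarrow> real" where
  "slope_l \<kappa> v i = (v (Suc i) - gcos \<kappa> (len i) * v i) / gsin \<kappa> (len i)"

definition slope_r :: "real \<Rightarrow> (nat \<Rightarrow> real) \<Rightarrow> nat \<Rightarrow> real" where
  "slope_r \<kappa> v i = (gcos \<kappa> (len i) * v (Suc i) - v i) / gsin \<kappa> (len i)"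

text \<open>Half the first variation of \<open>Q\<close> in direction h, arranged by slopes: a
  direction supported at one node reads off the derivative jump there.\<close>

definition Q_polar :: "real \<Rightarrow> real \<Rightarrow> (nat \<Rightarrow> real) \<Rightarrow> (nat \<Rightarrow> real) \<Rightarrow> real" where
  "Q_polar \<alpha> \<kappa> v h = (\<Sum>i\<le>N. slope_r \<kappa> v i * h (Suc i)) - (\<Sum>i\<le>N. slope_l \<kappa> v i * h i)
     + \<alpha> * (\<Sum>i\<in>{1..N}. v i * h i)"

section \<open>Expansion, homogeneity and normalisation of the form on node values\<close>

lemma Q_add: "Q \<alpha> \<kappa> (\<lambda>i. v i + t * h i) = Q \<alpha> \<kappa> v + 2 * t * Q_polar \<alpha> \<kappa> v h + t\<^sup>2 * Q \<alpha> \<kappa> h"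
\<comment> \<open>The identity \<open>e\<close> holds for every \<kappa>: where gsin vanishes, all
  the quotients are 0 by the convention for division.\<close>
proof -
  have e: "edge_form \<kappa> (len i) (v i + t * h i) (v (Suc i) + t * h (Suc i))
    = edge_form \<kappa> (len i) (v i) (v (Suc i))
      + 2 * t * (slope_r \<kappa> v i * h (Suc i) - slope_l \<kappa> v i * h i)
      + t\<^sup>2 * edge_form \<kappa> (len i) (h i) (h (Suc i))" for i
    unfolding edge_form_def slope_r_def slope_l_def
    by (cases "gsin \<kappa> (len i) = 0") (simp_all add: field_simps power2_eq_square)
  have f: "(v i + t * h i)\<^sup>2 = (v i)\<^sup>2 + 2 * t * (v i * h i) + t\<^sup>2 * (h i)\<^sup>2" for i
    by (simp add: power2_sum power_mult_distrib)
  show ?thesis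
    unfolding Q_def Q_polar_def e f
    by (simp add: sum.distrib sum_subtractf sum_distrib_left algebra_simps)
qed

lemma Q_scale: "Q \<alpha> \<kappa> (\<lambda>i. t * h i) = t\<^sup>2 * Q \<alpha> \<kappa> h"
  using Q_add[of \<alpha> \<kappa> "\<lambda>_. 0" t h]
  by (simp add: Q_def Q_polar_def edge_form_def slope_l_def slope_r_def)

lemma Q_cong: "(\<And>i. i \<le> Suc N \<Longrightarrow> v i = w i) \<Longrightarrow> Q \<alpha> \<kappa> v = Q \<alpha> \<kappa> w"
  by (simp add: Q_def)

text \<open>Vectors are functions on all of nat with the product topology. Bounding every
  coordinate, also those beyond \<open>Suc N\<close>, gives compactness by Tychonoff; the norm
  counts the doubled node once.\<close>

definition sphere :: "(nat \<Rightarrow> real) set" where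
  "sphere = {v. v (Suc N) = v 0 \<and> (\<Sum>i\<le>N. (v i)\<^sup>2) = 1 \<and> (\<forall>i. v i \<in> {-1..1})}"

lemma continuous_on_coord: "continuous_on A (\<lambda>v :: nat \<Rightarrow> real. v i)"
  by (rule continuous_on_subset[OF continuous_on_product_coordinates]) simp

lemma compact_sphere: "compact sphere"
proof -
  have "compactin (product_topology (\<lambda>_. euclidean) UNIV) (Pi\<^sub>E UNIV (\<lambda>_::nat. {-1..1::real}))"
    by (subst compactin_PiE) auto
  then have c: "compact (Pi\<^sub>E UNIV (\<lambda>_::nat. {-1..1::real}))"
    by (simp add: euclidean_product_topology)
  have "closed {v :: nat \<Rightarrow> real. v (Suc N) = v 0 \<and> (\<Sum>i\<le>N. (v i)\<^sup>2) = 1}"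
    by (intro closed_Collect_conj closed_Collect_eq continuous_intros continuous_on_coord)
  then have "compact (Pi\<^sub>E UNIV (\<lambda>_::nat. {-1..1::real}) \<inter> {v. v (Suc N) = v 0 \<and> (\<Sum>i\<le>N. (v i)\<^sup>2) = 1})"
    by (rule compact_Int_closed[OF c])
  also have "Pi\<^sub>E UNIV (\<lambda>_::nat. {-1..1::real}) \<inter> {v. v (Suc N) = v 0 \<and> (\<Sum>i\<le>N. (v i)\<^sup>2) = 1} = sphere"
    by (auto simp: sphere_def PiE_def Pi_def)
  finally show ?thesis .
qed

text \<open>By homogeneity; the factor c is independent of \<alpha> and \<kappa>, so the sign of
  \<open>Q\<close> is transferred for all parameters at once.\<close>

lemma normalise:
  assumes "v (Suc N) = v 0" "\<exists>i\<le>N. v i \<noteq> 0"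
  obtains w c where "w \<in> sphere" "0 < c" "\<And>\<alpha> \<kappa>. Q \<alpha> \<kappa> v = c * Q \<alpha> \<kappa> w"
proof -
  define s where "s = (\<Sum>i\<le>N. (v i)\<^sup>2)"
  have s: "0 < s" unfolding s_def using assms(2) by (auto intro!: sum_pos2)
  let ?w = "\<lambda>i. if i \<le> Suc N then v i / sqrt s else 0"
  have le: "(v i)\<^sup>2 \<le> s" if "i \<le> Suc N" for i
  proof -
    have "(v j)\<^sup>2 \<le> s" if "j \<le> N" for j
      unfolding s_def using that by (intro member_le_sum) auto
    from this[of i] this[of 0] show ?thesis using assms(1) that by (cases "i = Suc N") auto
  qed
  have "(\<Sum>i\<le>N. (?w i)\<^sup>2) = (\<Sum>i\<le>N. (v i)\<^sup>2) / s"
    using s by (simp add: power_divide sum_divide_distrib)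
  then have 1: "(\<Sum>i\<le>N. (?w i)\<^sup>2) = 1" using s by (simp add: s_def)
  have 2: "?w i \<in> {-1..1}" for i
  proof (cases "i \<le> Suc N")
    case True
    have "\<bar>v i\<bar> \<le> sqrt s" using real_le_rsqrt[of "\<bar>v i\<bar>"] le[OF True] by simp
    then have "- sqrt s \<le> v i" "v i \<le> sqrt s" by linarith+
    then show ?thesis using True s by (simp add: field_simps)
  qed simp
  have 3: "Q \<alpha> \<kappa> v = s * Q \<alpha> \<kappa> ?w" for \<alpha> \<kappa>
  proof -
    have "Q \<alpha> \<kappa> v = Q \<alpha> \<kappa> (\<lambda>i. sqrt s * ?w i)"
      using s by (intro Q_cong) simp
    then show ?thesis using s by (simp add: Q_scale)
  qed
  show thesis by (rule that[of ?w s]) (use assms(1) 1 2 3 s in \<open>auto simp: sphere_def\<close>)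
qed

section \<open>Dependence of the form on \<kappa>, and the left end of the window\<close>

lemma continuous_Q: "continuous_on ({-1/16..1/16} \<times> UNIV) (\<lambda>p. Q \<alpha> (fst p) (snd p))"
proof -
  have n: "gsin (fst p) (len i) \<noteq> 0" if "i \<le> N" "p \<in> {-1/16..1/16} \<times> (UNIV :: (nat \<Rightarrow> real) set)" for i p
  proof -
    have "\<bar>fst p\<bar> \<le> 1/16" using that(2) by auto
    from gsin_pos[OF this len_bounds[OF that(1)]] show ?thesis by simp
  qed
  have c: "continuous_on A (\<lambda>p :: real \<times> (nat \<Rightarrow> real). snd p i)" for A i
    using continuous_on_compose2[OF continuous_on_coord[of UNIV i] continuous_on_snd[OF continuous_on_id]] by auto
  have g: "continuous_on A (\<lambda>p :: real \<times> (nat \<Rightarrow> real). gcos (fst p) x)"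
    "continuous_on A (\<lambda>p :: real \<times> (nat \<Rightarrow> real). gsin (fst p) x)" for A x
    by (rule continuous_on_compose2[OF continuous_gcos] continuous_on_compose2[OF continuous_gsin]; auto intro!: continuous_intros)+
  show ?thesis
    unfolding Q_def edge_form_def using n by (intro continuous_intros c g) auto
qed

text \<open>Continuity in \<kappa>. It forces \<open>Q\<close> to be nonnegative at the least
  \<kappa>, since a negative value would persist further left, and it also gives the strict
  inequality.\<close>

lemma Q_slightly_less:
  assumes "-1/16 < \<kappa>" "\<kappa> \<le> 1/16" "Q \<alpha> \<kappa> v < 0"
  obtains \<kappa>' where "-1/16 < \<kappa>'" "\<kappa>' < \<kappa>" "Q \<alpha> \<kappa>' v < 0"
proof -
  have "continuous_on {-1/16..1/16} (\<lambda>\<kappa>. (\<lambda>p. Q \<alpha> (fst p) (snd p)) (\<kappa>, v))"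
    by (rule continuous_on_compose2[OF continuous_Q]) (auto intro!: continuous_intros)
  then have "((\<lambda>\<kappa>. Q \<alpha> \<kappa> v) \<longlongrightarrow> Q \<alpha> \<kappa> v) (at \<kappa> within {-1/16..1/16})"
    using assms by (simp add: continuous_on_def)
  then have "((\<lambda>\<kappa>. Q \<alpha> \<kappa> v) \<longlongrightarrow> Q \<alpha> \<kappa> v) (at \<kappa> within {-1/16..\<kappa>})"
    by (rule tendsto_within_subset) (use assms in auto)
  then have "((\<lambda>\<kappa>. Q \<alpha> \<kappa> v) \<longlongrightarrow> Q \<alpha> \<kappa> v) (at_left \<kappa>)"
    using assms(1) by (simp add: at_within_Icc_at_left)
  then have "\<forall>\<^sub>F \<kappa>' in at_left \<kappa>. Q \<alpha> \<kappa>' v < 0"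
    using assms(3) by (rule order_tendstoD)
  then obtain b where b: "b < \<kappa>" "\<And>y. b < y \<Longrightarrow> y < \<kappa> \<Longrightarrow> Q \<alpha> y v < 0"
    by (auto simp: eventually_at_left[OF assms(1)])
  obtain y where "max b (-1/16) < y" "y < \<kappa>" using dense[of "max b (-1/16)" \<kappa>] b assms(1) by auto
  then show thesis using that[of y] b by auto
qed

text \<open>Each edge is charged with the interaction at its left node only, for which its share of
  the bound \<open>edge_form_ge\<close> is already enough.\<close>

lemma Q_pos_of_small:
  assumes m: "\<And>i. i \<le> N \<Longrightarrow> \<bar>\<alpha>\<bar> < - gtan (-1/16) (len i)" and v: "v \<in> sphere"
  shows "0 < Q \<alpha> (-1/16) v"
proof -
  have s1: "(\<Sum>i\<le>N. (v i)\<^sup>2) = 1" using v by (simp add: sphere_def)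
  have "\<exists>i\<le>N. v i \<noteq> 0"
  proof (rule ccontr)
    assume "\<not> (\<exists>i\<le>N. v i \<noteq> 0)"
    then have "(\<Sum>i\<le>N. (v i)\<^sup>2) = 0" by simp
    with s1 show False by simp
  qed
  then obtain j where j: "j \<le> N" "v j \<noteq> 0" by blast
  have e: "\<bar>\<alpha>\<bar> * (v i)\<^sup>2 \<le> edge_form (-1/16) (len i) (v i) (v (Suc i))" (is ?a)
    "v i \<noteq> 0 \<Longrightarrow> \<bar>\<alpha>\<bar> * (v i)\<^sup>2 < edge_form (-1/16) (len i) (v i) (v (Suc i))" (is "_ \<Longrightarrow> ?b")
    if "i \<le> N" for i
  proof -
    have "- gtan (-1/16) (len i) * (v i)\<^sup>2 \<le> - gtan (-1/16) (len i) * ((v i)\<^sup>2 + (v (Suc i))\<^sup>2)"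
      using m[OF that] by (intro mult_left_mono) auto
    also have "\<dots> \<le> edge_form (-1/16) (len i) (v i) (v (Suc i))"
      by (rule edge_form_ge) (use len_bounds[OF that] in auto)
    finally have *: "- gtan (-1/16) (len i) * (v i)\<^sup>2 \<le> edge_form (-1/16) (len i) (v i) (v (Suc i))" .
    have "\<bar>\<alpha>\<bar> * (v i)\<^sup>2 \<le> - gtan (-1/16) (len i) * (v i)\<^sup>2"
      using m[OF that] by (intro mult_right_mono) auto
    with * show ?a by linarith
    assume "v i \<noteq> 0"
    then have "\<bar>\<alpha>\<bar> * (v i)\<^sup>2 < - gtan (-1/16) (len i) * (v i)\<^sup>2"
      using m[OF that] by (intro mult_strict_right_mono) auto
    with * show ?b by linarith
  qed
  have "\<bar>\<alpha>\<bar> * (\<Sum>i\<in>{1..N}. (v i)\<^sup>2) \<le> \<bar>\<alpha>\<bar> * (\<Sum>i\<le>N. (v i)\<^sup>2)"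
    by (intro mult_left_mono sum_mono2) auto
  also have "\<dots> = (\<Sum>i\<le>N. \<bar>\<alpha>\<bar> * (v i)\<^sup>2)" by (rule sum_distrib_left)
  also have "\<dots> < (\<Sum>i\<le>N. edge_form (-1/16) (len i) (v i) (v (Suc i)))"
    using e j by (intro sum_strict_mono_ex1) auto
  finally have "\<bar>\<alpha>\<bar> * (\<Sum>i\<in>{1..N}. (v i)\<^sup>2) < (\<Sum>i\<le>N. edge_form (-1/16) (len i) (v i) (v (Suc i)))" .
  moreover have "- (\<bar>\<alpha>\<bar> * (\<Sum>i\<in>{1..N}. (v i)\<^sup>2)) \<le> \<alpha> * (\<Sum>i\<in>{1..N}. (v i)\<^sup>2)"
    using mult_right_mono[of "- \<bar>\<alpha>\<bar>" \<alpha> "\<Sum>i\<in>{1..N}. (v i)\<^sup>2"] by (simp add: sum_nonneg)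
  ultimately show ?thesis unfolding Q_def by linarith
qed

text \<open>Vanishing first variation is the jump condition at the points of Y and smoothness at the
  cut, so interpolating a null vector by free solutions gives an eigenfunction. What remains is
  strict positivity.\<close>

lemma critical_point_lambda1:
  assumes k: "\<bar>\<kappa>\<bar> \<le> 1/16"
    and v: "v (Suc N) = v 0" "\<And>i. 0 \<le> v i" "\<exists>i\<le>N. v i \<noteq> 0"
    and crit: "\<And>h. h (Suc N) = h 0 \<Longrightarrow> Q_polar \<alpha> \<kappa> v h = 0"
  shows "lambda1 \<alpha> pts = \<kappa>"
proof -
  have S: "0 < gsin \<kappa> (len i)" if "i \<le> N" for i
    using gsin_pos[OF k len_bounds[OF that]] .
  have node: "slope_l \<kappa> v j - slope_r \<kappa> v (j - 1) = \<alpha> * v j" if j: "j \<in> {1..N}" for j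
  proof -
    have "(\<Sum>i\<le>N. slope_r \<kappa> v i * (if Suc i = j then 1 else 0)) = slope_r \<kappa> v (j - 1)"
    proof -
      have "(\<Sum>i\<le>N. slope_r \<kappa> v i * (if Suc i = j then 1 else 0))
        = (\<Sum>i\<le>N. if i = j - 1 then slope_r \<kappa> v i else 0)"
        using j by (intro sum.cong) auto
      also have "\<dots> = slope_r \<kappa> v (j - 1)" using j by (subst sum.delta) auto
      finally show ?thesis .
    qed
    moreover have "(\<Sum>i\<in>A. f i * (if i = j then 1 else 0)) = f j" if "finite A" "j \<in> A" for A and f :: "nat \<Rightarrow> real"
      using that sum.delta[of A j f] by (simp add: if_distrib[of "\<lambda>x. _ * x"] cong: if_cong)
    ultimately show ?thesis
      using crit[of "\<lambda>i. if i = j then 1 else 0"] j by (simp add: Q_polar_def)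
  qed
  have node0: "slope_l \<kappa> v 0 = slope_r \<kappa> v N"
  proof -
    \<comment> \<open>Both ends of the cut are the same point of the loop, so the test direction is
      1 at both.\<close>
    let ?h = "\<lambda>i. if i = 0 \<or> i = Suc N then 1 else (0::real)"
    have "(\<Sum>i\<le>N. slope_r \<kappa> v i * ?h (Suc i)) = (\<Sum>i\<le>N. if i = N then slope_r \<kappa> v i else 0)"
      by (intro sum.cong) auto
    moreover have "(\<Sum>i\<le>N. slope_l \<kappa> v i * ?h i) = (\<Sum>i\<le>N. if i = 0 then slope_l \<kappa> v i else 0)"
      by (intro sum.cong) auto
    moreover have "(\<Sum>i\<in>{1..N}. v i * ?h i) = 0"
      by (intro sum.neutral) auto
    ultimately show ?thesis
      using crit[of ?h] by (simp add: Q_polar_def)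
  qed
  \<comment> \<open>A discrete unique continuation: at a zero of a nonnegative vector the incoming
    slope is at most 0. The outgoing slope equals it there, so the next value is at most 0 as well;
    going round the loop, all values vanish.\<close>
  have zero_step: "v (Suc i) = 0" if i: "i \<le> N" and zi: "v i = 0" for i
  proof -
    have r: "slope_r \<kappa> v j \<le> 0" if "j \<le> N" "v (Suc j) = 0" for j
      using S[OF that(1)] v(2)[of j] that(2) by (simp add: slope_r_def divide_nonpos_pos)
    have "slope_l \<kappa> v i \<le> 0"
    proof (cases "i = 0")
      case True
      then show ?thesis using node0 r[of N] v(1) zi by simp
    next
      case False
      then show ?thesis using node[of i] r[of "i - 1"] zi i by simp
    qed
    then have "v (Suc i) / gsin \<kappa> (len i) \<le> 0" by (simp add: slope_l_def zi)
    then show ?thesis using S[OF i] v(2)[of "Suc i"]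
      by (smt (verit) divide_pos_pos)
  qed
  have zero_up: "v j = 0" if "v i = 0" "i \<le> j" "j \<le> Suc N" for i j
    using that(2,3)
  proof (induction j)
    case (Suc j) then show ?case using that(1) zero_step[of j] by (cases "i = Suc j") auto
  qed (use that in auto)
  have vpos: "0 < v i" if "i \<le> N" for i
  proof (rule ccontr)
    assume "\<not> 0 < v i"
    then have "v i = 0" using v(2)[of i] by simp
    then have "v 0 = 0" using zero_up[of i "Suc N"] that v(1) by simp
    then have "v j = 0" if "j \<le> N" for j using zero_up[of 0 j] that by simp
    with v(3) show False by blast
  qed
  have vpos': "0 < v i" if "i \<le> Suc N" for i
    using vpos[of i] vpos[of 0] v(1) that by (cases "i = Suc N") auto
  \<comment> \<open>The free solution with the prescribed end values, a combination of nonnegative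
    functions of which at least one is positive at each point.\<close>
  define p where "p i x = (v i * gsin \<kappa> (z (Suc i) - x) + v (Suc i) * gsin \<kappa> (x - z i)) / gsin \<kappa> (len i)" for i x
  define p' where "p' i x = (v (Suc i) * gcos \<kappa> (x - z i) - v i * gcos \<kappa> (z (Suc i) - x)) / gsin \<kappa> (len i)" for i x
  have pl: "p i (z i) = v i" "p' i (z i) = slope_l \<kappa> v i" if "i \<le> N" for i
    using S[OF that] by (simp_all add: p_def p'_def slope_l_def len_def mult.commute)
  have pr: "p i (z (Suc i)) = v (Suc i)" "p' i (z (Suc i)) = slope_r \<kappa> v i" if "i \<le> N" for i
    using S[OF that] by (simp_all add: p_def p'_def slope_r_def len_def mult.commute)
  show ?thesis
  proof (rule ground_state_of_pieces[where p=p and p'=p'])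
    fix i x assume i: "i \<le> N"
    have ds: "((\<lambda>x. gsin \<kappa> (c - x)) has_real_derivative - gcos \<kappa> (c - x)) (at x)"
      "((\<lambda>x. gcos \<kappa> (c - x)) has_real_derivative \<kappa> * gsin \<kappa> (c - x)) (at x)"
      "((\<lambda>x. gsin \<kappa> (x - c)) has_real_derivative gcos \<kappa> (x - c)) (at x)"
      "((\<lambda>x. gcos \<kappa> (x - c)) has_real_derivative - \<kappa> * gsin \<kappa> (x - c)) (at x)" for c
      by (auto intro!: DERIV_chain2[OF gsin_has_derivative, THEN DERIV_cong]
          DERIV_chain2[OF gcos_has_derivative, THEN DERIV_cong] derivative_eq_intros)
    show "(p i has_real_derivative p' i x) (at x)"
      unfolding p_def[abs_def] p'_def using S[OF i]
      by (auto intro!: derivative_eq_intros ds)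
    show "(p' i has_real_derivative - \<kappa> * p i x) (at x)"
      unfolding p_def p'_def[abs_def] using S[OF i]
      by (auto intro!: derivative_eq_intros ds simp: field_simps)
    assume x: "z i \<le> x" "x \<le> z (Suc i)"
    show "0 < p i x"
    proof (cases "x = z i")
      case True then show ?thesis using pl[OF i] vpos'[of i] i by simp
    next
      case False
      then have "0 < gsin \<kappa> (x - z i)"
        using x len_bounds[OF i] by (intro gsin_pos[OF k]) (auto simp: len_def)
      moreover have "0 \<le> gsin \<kappa> (z (Suc i) - x)"
      proof (cases "x = z (Suc i)")
        case False
        then show ?thesis using x len_bounds[OF i] by (intro less_imp_le[OF gsin_pos[OF k]]) (auto simp: len_def)
      qed simp
      ultimately show ?thesis
        unfolding p_def using S[OF i] vpos'[of i] vpos'[of "Suc i"] i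
        by (intro divide_pos_pos add_nonneg_pos) auto
    qed
  next
    fix i assume i: "i < N"
    then show "p i (z (Suc i)) = p (Suc i) (z (Suc i))" using pl[of "Suc i"] pr[of i] by simp
    show "p' (Suc i) (z (Suc i)) - p' i (z (Suc i)) = \<alpha> * p (Suc i) (z (Suc i))"
      using i pl[of "Suc i"] pr[of i] node[of "Suc i"] by simp
  next
    show "p N (2 * pi) = p 0 0" "p' N (2 * pi) = p' 0 0"
      using pl[of 0] pr[of N] z_0 z_end v(1) node0 by simp_all
  qed
qed

theorem lambda1_variational:
  assumes m: "\<And>i. i \<le> N \<Longrightarrow> \<bar>\<alpha>\<bar> < - gtan (-1/16) (len i)"
    and k0: "\<bar>\<kappa>\<^sub>0\<bar> \<le> 1/16" and w: "w (Suc N) = w 0" "\<exists>i\<le>N. w i \<noteq> 0"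
    and Q0: "Q \<alpha> \<kappa>\<^sub>0 w \<le> 0"
  shows "lambda1 \<alpha> pts \<le> \<kappa>\<^sub>0" "Q \<alpha> \<kappa>\<^sub>0 w < 0 \<Longrightarrow> lambda1 \<alpha> pts < \<kappa>\<^sub>0"
proof -
  let ?A = "{-1/16..1/16::real} \<times> sphere"
  let ?P = "{p \<in> ?A. Q \<alpha> (fst p) (snd p) \<in> {..0}}"
  have cA: "compact ?A" by (intro compact_Times compact_sphere) auto
  have "closedin (top_of_set ?A) (?A \<inter> (\<lambda>p. Q \<alpha> (fst p) (snd p)) -` {..0})"
    by (rule continuous_closedin_preimage) (auto intro: continuous_on_subset[OF continuous_Q])
  moreover have "?A \<inter> (\<lambda>p. Q \<alpha> (fst p) (snd p)) -` {..0} = ?P" by auto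
  ultimately have cP: "compact ?P" using closedin_compact[OF cA] by simp
  obtain w' c where w': "w' \<in> sphere" "0 < c" "\<And>\<alpha> \<kappa>. Q \<alpha> \<kappa> w = c * Q \<alpha> \<kappa> w'"
    using normalise[OF w] by metis
  have "(\<kappa>\<^sub>0, w') \<in> ?P" using w' Q0 k0 by (auto simp: mult_le_0_iff abs_le_iff)
  then obtain p where p: "p \<in> ?P" and pmin: "\<And>q. q \<in> ?P \<Longrightarrow> fst p \<le> fst q"
    using continuous_attains_inf[OF cP, of fst] continuous_on_fst[OF continuous_on_id] by blast
  obtain \<kappa> v where pv: "p = (\<kappa>, v)" by (cases p)
  have v: "v \<in> sphere" and k: "\<bar>\<kappa>\<bar> \<le> 1/16" and Qv: "Q \<alpha> \<kappa> v \<le> 0"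
    using p by (auto simp: pv abs_le_iff)
  have min: "\<kappa> \<le> \<kappa>'" if "\<bar>\<kappa>'\<bar> \<le> 1/16" "u \<in> sphere" "Q \<alpha> \<kappa>' u \<le> 0" for \<kappa>' u
  proof -
    have "(\<kappa>', u) \<in> ?P" using that by (auto simp: abs_le_iff)
    from pmin[OF this] show ?thesis by (simp add: pv)
  qed
  have "\<kappa> \<noteq> -1/16" using Q_pos_of_small[OF m v] Qv by auto
  then have kl: "-1/16 < \<kappa>" "\<kappa> \<le> 1/16" using k by (auto simp: abs_le_iff)
  have Qs: "0 \<le> Q \<alpha> \<kappa> u" if "u \<in> sphere" for u
  proof (rule ccontr)
    assume "\<not> 0 \<le> Q \<alpha> \<kappa> u"
    then obtain \<kappa>' where "-1/16 < \<kappa>'" "\<kappa>' < \<kappa>" "Q \<alpha> \<kappa>' u < 0"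
      using Q_slightly_less[OF kl, of \<alpha> u] by (metis not_le)
    moreover from this have "\<bar>\<kappa>'\<bar> \<le> 1/16" using kl by linarith
    ultimately show False using min[OF _ that, of \<kappa>'] by auto
  qed
  have Qn: "0 \<le> Q \<alpha> \<kappa> u" if per: "u (Suc N) = u 0" for u
  proof (cases "\<exists>i\<le>N. u i \<noteq> 0")
    case True
    then obtain u' c where "u' \<in> sphere" "0 < c" "\<And>\<alpha> \<kappa>. Q \<alpha> \<kappa> u = c * Q \<alpha> \<kappa> u'"
      using normalise[OF per True] by metis
    then show ?thesis using Qs[of u'] by simp
  next
    case False
    then have "u i = 0" if "i \<le> Suc N" for i
      using that per by (cases "i = Suc N") auto
    then have "Q \<alpha> \<kappa> u = Q \<alpha> \<kappa> (\<lambda>_. 0)" by (rule Q_cong)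
    then show ?thesis by (simp add: Q_def edge_form_def)
  qed
  let ?v = "\<lambda>i. \<bar>v i\<bar>"
  have v0: "?v (Suc N) = ?v 0" using v by (simp add: sphere_def)
  \<comment> \<open>With \<open>Qn\<close>, passing to absolute values keeps a null vector
    null.\<close>
  have "Q \<alpha> \<kappa> ?v \<le> Q \<alpha> \<kappa> v"
    unfolding Q_def using len_bounds
    by (auto intro!: sum_mono edge_form_abs_le[OF k])
  then have Qz: "Q \<alpha> \<kappa> ?v = 0" using Qn[OF v0] Qv by linarith
  have "lambda1 \<alpha> pts = \<kappa>"
  proof (rule critical_point_lambda1[OF k v0])
    show "0 \<le> ?v i" for i by simp
    show "\<exists>i\<le>N. ?v i \<noteq> 0"
    proof (rule ccontr)
      assume "\<not> (\<exists>i\<le>N. ?v i \<noteq> 0)"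
      then have "(\<Sum>i\<le>N. (v i)\<^sup>2) = 0" by simp
      with v show False by (simp add: sphere_def)
    qed
    fix h :: "nat \<Rightarrow> real" assume h: "h (Suc N) = h 0"
    show "Q_polar \<alpha> \<kappa> ?v h = 0"
    proof (rule quadratic_linear_coeff_zero)
      fix t
      show "0 \<le> 2 * t * Q_polar \<alpha> \<kappa> ?v h + t\<^sup>2 * Q \<alpha> \<kappa> h"
        using Qn[of "\<lambda>i. ?v i + t * h i"] v0 h unfolding Q_add Qz by simp
    qed
  qed
  moreover have "\<kappa> \<le> \<kappa>\<^sub>0"
    using min[OF k0 w'(1)] w' Q0 by (simp add: mult_le_0_iff)
  \<comment> \<open>A negative value survives at some smaller parameter, which the least \<kappa>
    cannot exceed.\<close>
  moreover have "\<kappa> < \<kappa>\<^sub>0" if "Q \<alpha> \<kappa>\<^sub>0 w < 0"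
  proof -
    have "-1/16 < \<kappa>\<^sub>0" "\<kappa>\<^sub>0 \<le> 1/16" using \<open>\<kappa> \<le> \<kappa>\<^sub>0\<close> kl k0 by (auto simp: abs_le_iff)
    moreover have q: "Q \<alpha> \<kappa>\<^sub>0 w' < 0" using that w' by (simp add: mult_less_0_iff)
    ultimately obtain \<kappa>' where "-1/16 < \<kappa>'" "\<kappa>' < \<kappa>\<^sub>0" "Q \<alpha> \<kappa>' w' < 0"
      using Q_slightly_less[of \<kappa>\<^sub>0 \<alpha> w'] by metis
    moreover from this have "\<bar>\<kappa>'\<bar> \<le> 1/16" using \<open>\<kappa>\<^sub>0 \<le> 1/16\<close> by linarith
    ultimately show ?thesis using min[OF _ w'(1), of \<kappa>'] by auto
  qed
  ultimately show "lambda1 \<alpha> pts \<le> \<kappa>\<^sub>0" "Q \<alpha> \<kappa>\<^sub>0 w < 0 \<Longrightarrow> lambda1 \<alpha> pts < \<kappa>\<^sub>0" by auto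
qed

end

section \<open>Comparison with equidistant points\<close>

lemma gsin_minus [simp]: "gsin \<kappa> (- x) = - gsin \<kappa> x"
  by (simp add: gsin_def)

lemma gtan_double:
  assumes "gcos \<kappa> a \<noteq> 0"
  shows "gtan \<kappa> (2 * a) * gcos \<kappa> a = \<kappa> * gsin \<kappa> a"
proof -
  have "1 + gcos \<kappa> (2 * a) = 2 * (gcos \<kappa> a)\<^sup>2"
    using gcos_add[of \<kappa> a a] gcos_gsin_square[of \<kappa> a] by (simp add: power2_eq_square)
  moreover have "gsin \<kappa> (2 * a) = 2 * gsin \<kappa> a * gcos \<kappa> a"
    using gsin_add[of \<kappa> a a] by simp
  ultimately show ?thesis using assms by (simp add: gtan_def power2_eq_square)
qed

text \<open>The ground state on each gap is \<open>gcos\<close> centred at the midpoint 2 a i. The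
  cut is itself such a midpoint, where value and slope agree with those at 2 pi; at a node the
  slopes are opposite, and \<open>gtan_double\<close> turns their jump into the stated
  \<alpha>.\<close>

lemma lambda1_Y_tilde:
  assumes N: "1 \<le> N" and k: "\<bar>\<kappa>\<bar> \<le> 1/16"
  shows "lambda1 (2 * gtan \<kappa> (2 * pi / N)) (Y_tilde N) = \<kappa>"
proof -
  define a where "a = pi / real N"
  have a: "0 < a" "a \<le> pi" using N by (auto simp: a_def field_simps)
  have Na: "real N * a = pi" using N by (simp add: a_def)
  define z where "z i = (if i = 0 then 0 else if i = Suc N then 2 * pi else a * (2 * real i - 1))" for i
  interpret loop_partition N z
  proof
    show "z 0 = 0" "z (Suc N) = 2 * pi" by (auto simp: z_def)
    fix i assume "i \<le> N"
    show "z i < z (Suc i)"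
    proof (cases "i = N")
      case True
      then have "z i = 2 * pi - a" using N Na by (simp add: z_def algebra_simps)
      then show ?thesis using True a by (simp add: z_def)
    next
      case False
      then show ?thesis using \<open>i \<le> N\<close> a by (auto simp: z_def)
    qed
  qed
  have pts: "pts = Y_tilde N"
    unfolding Y_tilde_def by (intro image_cong) (auto simp: z_def a_def)
  have zS: "z (Suc i) = 2 * a * i + a" if "i < N" for i
    using that by (simp add: z_def algebra_simps)
  have cpos: "0 < gcos \<kappa> a" using gcos_pos[OF k] a by simp
  have alpha: "2 * gtan \<kappa> (2 * a) * gcos \<kappa> a = 2 * (\<kappa> * gsin \<kappa> a)"
    using gtan_double[of \<kappa> a] cpos by simp
  have "lambda1 (2 * gtan \<kappa> (2 * a)) pts = \<kappa>"
  proof (rule ground_state_of_pieces[where p="\<lambda>i x. gcos \<kappa> (x - 2 * a * i)"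
        and p'="\<lambda>i x. - \<kappa> * gsin \<kappa> (x - 2 * a * i)"])
    fix i x assume i: "i \<le> N"
    show "((\<lambda>x. gcos \<kappa> (x - 2 * a * i)) has_real_derivative - \<kappa> * gsin \<kappa> (x - 2 * a * i)) (at x)"
      by (auto intro!: DERIV_chain2[OF gcos_has_derivative, THEN DERIV_cong] derivative_eq_intros)
    show "((\<lambda>x. - \<kappa> * gsin \<kappa> (x - 2 * a * i)) has_real_derivative - \<kappa> * gcos \<kappa> (x - 2 * a * i)) (at x)"
      by (auto intro!: DERIV_cmult DERIV_chain2[OF gsin_has_derivative, THEN DERIV_cong] derivative_eq_intros)
    assume x: "z i \<le> x" "x \<le> z (Suc i)"
    have "2 * a * i - a \<le> z i"
      using i a zS[of "i - 1"] by (cases "i = 0") (auto simp: z_0 algebra_simps of_nat_diff)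
    moreover have "z (Suc i) \<le> 2 * a * i + a"
    proof (cases "i = N")
      case True
      then have "2 * a * i = 2 * pi" using Na by (simp add: algebra_simps)
      then show ?thesis using True a z_end by simp
    qed (use i zS in auto)
    ultimately have "\<bar>x - 2 * a * i\<bar> \<le> pi" using x a by (auto simp: abs_le_iff)
    then show "0 < gcos \<kappa> (x - 2 * a * i)" by (rule gcos_pos[OF k])
  next
    fix i assume i: "i < N"
    have e: "z (Suc i) - 2 * a * i = a" "z (Suc i) - 2 * a * Suc i = - a"
      using zS[OF i] by (auto simp: algebra_simps)
    show "gcos \<kappa> (z (Suc i) - 2 * a * i) = gcos \<kappa> (z (Suc i) - 2 * a * Suc i)"
      unfolding e by simp
    show "- \<kappa> * gsin \<kappa> (z (Suc i) - 2 * a * Suc i) - - \<kappa> * gsin \<kappa> (z (Suc i) - 2 * a * i)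
      = 2 * gtan \<kappa> (2 * a) * gcos \<kappa> (z (Suc i) - 2 * a * Suc i)"
      unfolding e using alpha by simp
  next
    have e: "2 * pi - 2 * a * N = 0" using Na by (simp add: algebra_simps)
    show "gcos \<kappa> (2 * pi - 2 * a * N) = gcos \<kappa> (0 - 2 * a * (0::nat))"
      "- \<kappa> * gsin \<kappa> (2 * pi - 2 * a * N) = - \<kappa> * gsin \<kappa> (0 - 2 * a * (0::nat))"
      unfolding e by simp_all
  qed
  then show ?thesis unfolding pts by (simp add: a_def)
qed

text \<open>Eliminating the value at the auxiliary node, where the loop is cut open, merges two intervals into one.\<close>

lemma edge_form_merge:
  assumes k: "\<bar>\<kappa>\<bar> \<le> 1/16" and a: "0 < a" "0 < b" "a + b \<le> 2 * pi"
  defines "m \<equiv> (gsin \<kappa> a + gsin \<kappa> b) / gsin \<kappa> (a + b)"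
  shows "edge_form \<kappa> a m 1 + edge_form \<kappa> b 1 m = - 2 * gtan \<kappa> (a + b)"
proof -
  define A B C D S where "A = gsin \<kappa> a" and "B = gsin \<kappa> b" and "C = gcos \<kappa> a" and "D = gcos \<kappa> b"
    and "S = gsin \<kappa> (a + b)"
  have p: "0 < A" "0 < B" "0 < S" using gsin_pos[OF k] a by (auto simp: A_def B_def S_def)
  have S: "S = A * D + C * B" by (simp add: S_def A_def B_def C_def D_def gsin_add)
  have q: "C\<^sup>2 + \<kappa> * A\<^sup>2 = 1" "D\<^sup>2 + \<kappa> * B\<^sup>2 = 1"
    by (simp_all add: A_def B_def C_def D_def gcos_gsin_square)
  have key: "S\<^sup>2 - (A + B)\<^sup>2 = 2 * (A * B) * (C * D - \<kappa> * A * B - 1)"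
    using q unfolding S by algebra
  \<comment> \<open>m is the value, at the auxiliary node, of the free solution on the merged
    interval with value 1 at both ends.\<close>
  have m: "m * S = A + B" using p by (simp add: m_def A_def B_def S_def)
  have g: "- 2 * gtan \<kappa> (a + b) = 2 * (C * D - \<kappa> * A * B - 1) / S"
    using p a by (subst gtan_eq[OF k]) (auto simp: S_def A_def B_def C_def D_def gcos_add field_simps)
  have "edge_form \<kappa> a m 1 + edge_form \<kappa> b 1 m = (C * (m\<^sup>2 + 1) - 2 * m) / A + (D * (m\<^sup>2 + 1) - 2 * m) / B"
    by (simp add: edge_form_def A_def B_def C_def D_def add.commute)
  also have "\<dots> = (S * (m\<^sup>2 + 1) - 2 * m * (A + B)) / (A * B)"
    using p unfolding S by (simp add: field_simps)
  also have "\<dots> = (S\<^sup>2 * (m\<^sup>2 + 1) - 2 * (m * S) * (A + B)) / (A * B * S)"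
    using p by (simp add: field_simps power2_eq_square)
  also have "S\<^sup>2 * (m\<^sup>2 + 1) - 2 * (m * S) * (A + B) = S\<^sup>2 - (A + B)\<^sup>2"
    using m by algebra
  also have "(S\<^sup>2 - (A + B)\<^sup>2) / (A * B * S) = 2 * (C * D - \<kappa> * A * B - 1) / S"
    unfolding key using p by (simp add: field_simps)
  finally show ?thesis using g by simp
qed

lemma edge_form_one:
  assumes "\<bar>\<kappa>\<bar> \<le> 1/16" "0 < l" "l \<le> 2 * pi"
  shows "edge_form \<kappa> l 1 1 = - 2 * gtan \<kappa> l"
  unfolding gtan_eq[OF assms] edge_form_def using gsin_pos[OF assms] by (simp add: field_simps)

definition rotate_loop :: "real \<Rightarrow> real \<Rightarrow> real" where
  "rotate_loop c x = (if x + c < 0 then x + c + 2 * pi else if x + c < 2 * pi then x + c else x + c - 2 * pi)"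

lemma loop_isometry_rotate:
  assumes "\<bar>c\<bar> < 2 * pi"
  shows "loop_isometry (rotate_loop c)"
  unfolding loop_isometry_def
proof (intro conjI ballI)
  have in_loop: "rotate_loop d x \<in> loop" if "x \<in> loop" "\<bar>d\<bar> < 2 * pi" for d x
    using that unfolding loop_def rotate_loop_def atLeastLessThan_iff by (smt (verit))
  have inv: "rotate_loop (- d) (rotate_loop d x) = x" if "x \<in> loop" "\<bar>d\<bar> < 2 * pi" for d x
    using that unfolding loop_def rotate_loop_def atLeastLessThan_iff by (smt (verit))
  show "bij_betw (rotate_loop c) loop loop"
    by (rule bij_betw_byWitness[where f'="rotate_loop (- c)"])
      (use assms in_loop[of _ c] in_loop[of _ "- c"] inv[of _ c] inv[of _ "- c"] in auto)
  show "loop_dist (rotate_loop c x) (rotate_loop c y) = loop_dist x y" if "x \<in> loop" "y \<in> loop" for x y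
    using that assms unfolding loop_def rotate_loop_def loop_dist_def atLeastLessThan_iff min_def
    by (smt (verit))
qed

section \<open>Gaps on the loop, the test vector, and the equality case\<close>

context loop_partition
begin

text \<open>Arc from \<open>z j\<close> to the next point of Y; the last arc crosses the cut and
  joins two intervals.\<close>

definition gap :: "nat \<Rightarrow> real" where
  "gap j = (if j < N then len j else len N + len 0)"

lemma sum_len: "(\<Sum>i\<le>N. len i) = 2 * pi"
  using sum_lessThan_telescope[of z "Suc N"] z_0 z_end by (simp add: len_def lessThan_Suc_atMost)

lemma sum_ends:
  fixes f :: "nat \<Rightarrow> real"
  assumes "1 \<le> N"
  shows "(\<Sum>i\<le>N. f i) = f 0 + (\<Sum>i\<in>{1..<N}. f i) + f N"
proof -
  have "{..N} = insert 0 (insert N {1..<N})" using assms by auto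
  then show ?thesis using assms by simp
qed

lemma sum_gap:
  assumes "1 \<le> N"
  shows "(\<Sum>j\<in>{1..N}. f (gap j)) = (\<Sum>j\<in>{1..<N}. f (len j)) + (f (len N + len 0) :: real)"
proof -
  have "{1..N} = insert N {1..<N}" using assms by auto
  then show ?thesis by (simp add: gap_def)
qed

lemma gap_bounds:
  assumes "j \<in> {1..N}"
  shows "0 < gap j" "gap j \<le> 2 * pi"
proof -
  have pos: "0 < gap j" if "j \<in> {1..N}" for j using len_bounds(1)[of j] len_bounds(1)[of 0] len_bounds(1)[of N] that
    by (auto simp: gap_def)
  have "gap j \<le> (\<Sum>j\<in>{1..N}. gap j)"
    using assms pos by (intro member_le_sum) (auto intro: less_imp_le)
  also have "\<dots> = 2 * pi"
    using sum_gap[of "\<lambda>x. x"] sum_ends[of len] sum_len assms by simp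
  finally show "gap j \<le> 2 * pi" .
  show "0 < gap j" by (rule pos[OF assms])
qed

text \<open>The value at the cut is the one that merges its two intervals, so the cut leaves no
  trace and only the gaps enter.\<close>

lemma test_vector:
  assumes N: "1 \<le> N" and k: "\<bar>\<kappa>\<bar> \<le> 1/16"
  obtains v where "v (Suc N) = v 0" "\<exists>i\<le>N. v i \<noteq> 0"
    "\<And>\<alpha>. Q \<alpha> \<kappa> v = \<alpha> * N - 2 * (\<Sum>j\<in>{1..N}. gtan \<kappa> (gap j))"
proof -
  define m where "m = (gsin \<kappa> (len 0) + gsin \<kappa> (len N)) / gsin \<kappa> (len 0 + len N)"
  define v where "v i = (if i = 0 \<or> i = Suc N then m else 1)" for i
  have g: "0 < len 0" "0 < len N" "len 0 + len N \<le> 2 * pi"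
    using len_bounds[of 0] len_bounds[of N] gap_bounds[of N] N by (auto simp: gap_def)
  have "(\<Sum>i\<in>{1..<N}. edge_form \<kappa> (len i) (v i) (v (Suc i))) = (\<Sum>i\<in>{1..<N}. - 2 * gtan \<kappa> (len i))"
    using edge_form_one[OF k] len_bounds by (intro sum.cong) (auto simp: v_def)
  then have "(\<Sum>i\<le>N. edge_form \<kappa> (len i) (v i) (v (Suc i)))
    = (edge_form \<kappa> (len 0) m 1 + edge_form \<kappa> (len N) 1 m) + (\<Sum>i\<in>{1..<N}. - 2 * gtan \<kappa> (len i))"
    using N by (simp add: sum_ends v_def)
  also have "\<dots> = - 2 * gtan \<kappa> (len 0 + len N) + (\<Sum>i\<in>{1..<N}. - 2 * gtan \<kappa> (len i))"
    unfolding m_def by (simp only: edge_form_merge[OF k g])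
  also have "\<dots> = - 2 * (\<Sum>j\<in>{1..N}. gtan \<kappa> (gap j))"
    unfolding sum_gap[OF N] by (simp add: sum_distrib_left sum_negf add.commute[of "len N"])
  finally have e: "(\<Sum>i\<le>N. edge_form \<kappa> (len i) (v i) (v (Suc i))) = - 2 * (\<Sum>j\<in>{1..N}. gtan \<kappa> (gap j))" .
  have "(\<Sum>i\<in>{1..N}. (v i)\<^sup>2) = real N" by (simp add: v_def)
  then have "Q \<alpha> \<kappa> v = \<alpha> * N - 2 * (\<Sum>j\<in>{1..N}. gtan \<kappa> (gap j))" for \<alpha>
    unfolding Q_def e by simp
  moreover have "\<exists>i\<le>N. v i \<noteq> 0" using N by (intro exI[of _ 1]) (auto simp: v_def)
  ultimately show thesis by (intro that[of v]) (auto simp: v_def)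
qed

text \<open>Jensen's inequality by the tangent at the mean gap: the gaps sum to 2 pi, so the linear
  terms cancel. One gap off the mean makes it strict.\<close>

lemma sum_gtan_gap:
  assumes N: "1 \<le> N" and k: "\<bar>\<kappa>\<bar> \<le> 1/16"
  shows "N * gtan \<kappa> (2 * pi / N) \<le> (\<Sum>j\<in>{1..N}. gtan \<kappa> (gap j))"
    and "\<kappa> \<noteq> 0 \<Longrightarrow> j \<in> {1..N} \<Longrightarrow> gap j \<noteq> 2 * pi / N \<Longrightarrow>
      N * gtan \<kappa> (2 * pi / N) < (\<Sum>j\<in>{1..N}. gtan \<kappa> (gap j))"
proof -
  let ?l = "2 * pi / N"
  let ?t = "\<lambda>j. gtan \<kappa> ?l + \<kappa> / (1 + gcos \<kappa> ?l) * (gap j - ?l)"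
  have l: "0 \<le> ?l" "?l \<le> 2 * pi" using N by (auto simp: field_simps)
  have "(\<Sum>j\<in>{1..N}. gap j - ?l) = 0"
    using sum_gap[OF N, of "\<lambda>x. x"] sum_ends[OF N, of len] sum_len N by (simp add: sum_subtractf)
  then have "(\<Sum>j\<in>{1..N}. ?t j) = N * gtan \<kappa> ?l"
    by (simp only: sum.distrib sum_distrib_left[symmetric]) simp
  moreover have le: "?t i \<le> gtan \<kappa> (gap i)" if "i \<in> {1..N}" for i
    using gap_bounds[OF that] by (intro gtan_tangent k l) auto
  ultimately show "N * gtan \<kappa> ?l \<le> (\<Sum>j\<in>{1..N}. gtan \<kappa> (gap j))"
    using sum_mono[of "{1..N}" ?t "\<lambda>j. gtan \<kappa> (gap j)"] by simp
  assume "\<kappa> \<noteq> 0" "j \<in> {1..N}" "gap j \<noteq> ?l"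
  then have "?t j < gtan \<kappa> (gap j)"
    using gap_bounds[of j] by (intro gtan_tangent_strict k l) auto
  then have "(\<Sum>j\<in>{1..N}. ?t j) < (\<Sum>j\<in>{1..N}. gtan \<kappa> (gap j))"
    using le \<open>j \<in> {1..N}\<close> by (intro sum_strict_mono_ex1) auto
  then show "N * gtan \<kappa> ?l < (\<Sum>j\<in>{1..N}. gtan \<kappa> (gap j))"
    using \<open>(\<Sum>j\<in>{1..N}. ?t j) = N * gtan \<kappa> ?l\<close> by simp
qed

text \<open>Equal gaps fix Y up to its first point, and the rotation taking that point to pi / N
  does the rest; no point of Y wraps around.\<close>

lemma congruent_of_equal_gaps:
  assumes N: "1 \<le> N" and eq: "\<And>j. j \<in> {1..N} \<Longrightarrow> gap j = 2 * pi / N"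
  shows "congruent_sets pts (Y_tilde N)"
proof -
  have zj: "z (Suc j) = z 1 + j * (2 * pi / N)" if "j < N" for j
    using that
  proof (induction j)
    case (Suc j)
    have "z (Suc (Suc j)) - z (Suc j) = 2 * pi / N"
      using eq[of "Suc j"] Suc.prems by (simp add: gap_def len_def)
    then show ?case using Suc by (simp add: algebra_simps add_divide_distrib)
  qed simp
  have z1: "0 < z 1" "z 1 < 2 * pi / N"
    using len_bounds[of 0] len_bounds(1)[of N] eq[of N] N z_0 by (auto simp: gap_def len_def)
  define c where "c = pi / N - z 1"
  have l: "2 * pi / N = 2 * (pi / N)" "0 < pi / N" "pi / N \<le> pi" using N by (auto simp: field_simps)
  have c: "\<bar>c\<bar> < 2 * pi" using z1 l pi_gt_zero unfolding c_def abs_less_iff by (intro conjI) linarith+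
  have rot: "rotate_loop c (z j) = pi / real N * (2 * real j - 1)" if "j \<in> {1..N}" for j
  proof -
    have "z j = z 1 + (real j - 1) * (2 * pi / N)" using zj[of "j - 1"] that by (auto simp: of_nat_diff)
    then have e: "z j + c = pi / real N * (2 * real j - 1)"
      unfolding c_def using N by (simp add: field_simps)
    have "0 \<le> pi / real N * (2 * real j - 1)" using that by auto
    moreover have "pi / real N * (2 * real j - 1) < pi / real N * (2 * real N)"
      using that l(2) by (intro mult_strict_left_mono) auto
    ultimately show ?thesis unfolding rotate_loop_def e using N by simp
  qed
  have "rotate_loop c ` pts = Y_tilde N"
    unfolding Y_tilde_def image_image using rot by (intro image_cong) auto
  then show ?thesis using loop_isometry_rotate[OF c] by (auto simp: congruent_sets_def)
qed

end

lemma loop_partition_of_set: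
  assumes "finite Y" "card Y = N" "Y \<subseteq> {0<..<2 * pi}"
  obtains z where "loop_partition N z" "z ` {1..N} = Y"
proof -
  define xs where "xs = sorted_list_of_set Y"
  have xs: "set xs = Y" "length xs = N" "sorted_wrt (<) xs"
    using assms by (auto simp: xs_def)
  \<comment> \<open>Index 0 is the cut, so list positions are shifted by one.\<close>
  define z where "z i = (if i = 0 then 0 else if i = Suc N then 2 * pi else xs ! (i - 1))" for i
  have mem: "xs ! i \<in> {0<..<2 * pi}" if "i < N" for i
    using nth_mem[of i xs] xs assms(3) that by auto
  have "loop_partition N z"
  proof
    fix i assume i: "i \<le> N"
    have "xs ! (i - 1) < xs ! i" if "0 < i" "i < N"
      using sorted_wrt_nth_less[OF xs(3), of "i - 1" i] that xs(2) by simp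
    then show "z i < z (Suc i)"
      using i mem[of i] mem[of "i - 1"] by (cases "i = 0"; cases "i = N") (auto simp: z_def)
  qed (auto simp: z_def)
  moreover have "z ` {1..N} = Y"
  proof -
    have "z ` {1..N} = (\<lambda>i. xs ! i) ` {..<N}"
    proof -
      have "{1..N} = Suc ` {..<N}" by (auto simp: image_Suc_lessThan)
      then have "z ` {1..N} = (\<lambda>i. z (Suc i)) ` {..<N}" by (simp add: image_image)
      also have "\<dots> = (\<lambda>i. xs ! i) ` {..<N}" by (intro image_cong) (auto simp: z_def)
      finally show ?thesis .
    qed
    also have "\<dots> = set xs" using xs(2) by (auto simp: set_conv_nth)
    finally show ?thesis using xs(1) by simp
  qed
  ultimately show thesis by (rule that)
qed

theorem theorem5p1:
  fixes N :: nat and Y :: "real set"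
  assumes "N \<ge> 2"
    and "finite Y" and "card Y = N" and "Y \<subseteq> {0<..<2 * pi}"
  shows "\<exists>\<alpha>\<^sub>0>0.
    (\<forall>\<alpha>::real. \<bar>\<alpha>\<bar> < \<alpha>\<^sub>0 \<longrightarrow> lambda1 \<alpha> Y \<le> lambda1 \<alpha> (Y_tilde N)) \<and>
    (\<not> congruent_sets Y (Y_tilde N) \<longrightarrow>
      (\<forall>\<alpha>::real. 0 < \<bar>\<alpha>\<bar> \<and> \<bar>\<alpha>\<bar> < \<alpha>\<^sub>0 \<longrightarrow> lambda1 \<alpha> Y < lambda1 \<alpha> (Y_tilde N)))"
proof -
  obtain z where z: "loop_partition N z" and Y: "z ` {1..N} = Y"
    using loop_partition_of_set[OF assms(2-4)] .
  interpret loop_partition N z by (rule z)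
  have N: "1 \<le> N" using assms(1) by simp
  let ?l = "2 * pi / N"
  have l: "0 < ?l" "?l \<le> 2 * pi" using N by (auto simp: field_simps)
  define m where "m = Min ((\<lambda>i. - gtan (-1/16) (len i)) ` {..N})"
  \<comment> \<open>The bound m gives positivity at \<kappa> = -1/16; the other two are the ends of
    the range of \<kappa> \<mapsto> 2 gtan \<kappa> ?l on the window, as the intermediate value
    theorem requires.\<close>
  define \<alpha>\<^sub>0 where "\<alpha>\<^sub>0 = min m (min (2 * gtan (1/16) ?l) (- 2 * gtan (-1/16) ?l))"
  have "0 < m"
    unfolding m_def using gtan_sgn(2)[of "-1/16"] len_bounds by (subst Min_gr_iff) auto
  moreover have "0 < gtan (1/16) ?l" "gtan (-1/16) ?l < 0"
    using gtan_sgn(1)[of "1/16" ?l] gtan_sgn(2)[of "-1/16" ?l] l by auto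
  ultimately have pos: "0 < \<alpha>\<^sub>0" by (simp add: \<alpha>\<^sub>0_def)
  have small: "\<bar>\<alpha>\<bar> < - gtan (-1/16) (len i)" if "\<bar>\<alpha>\<bar> < \<alpha>\<^sub>0" "i \<le> N" for \<alpha> i
  proof -
    have "m \<le> - gtan (-1/16) (len i)" unfolding m_def using that by (intro Min_le) auto
    then show ?thesis using that by (simp add: \<alpha>\<^sub>0_def)
  qed
  have tilde: "\<exists>\<kappa>. \<bar>\<kappa>\<bar> \<le> 1/16 \<and> \<alpha> = 2 * gtan \<kappa> ?l" if "\<bar>\<alpha>\<bar> < \<alpha>\<^sub>0" for \<alpha>
  proof -
    have "\<exists>\<kappa>. -1/16 \<le> \<kappa> \<and> \<kappa> \<le> 1/16 \<and> 2 * gtan \<kappa> ?l = \<alpha>"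
    proof (rule IVT')
      show "2 * gtan (-1/16) ?l \<le> \<alpha>" "\<alpha> \<le> 2 * gtan (1/16) ?l"
        using that by (auto simp: \<alpha>\<^sub>0_def)
      show "continuous_on {-1/16..1/16} (\<lambda>\<kappa>. 2 * gtan \<kappa> ?l)"
        using l by (intro continuous_intros continuous_gtan) auto
    qed simp
    then show ?thesis by (metis abs_le_iff minus_divide_left minus_le_iff)
  qed
  have main: "lambda1 \<alpha> Y \<le> lambda1 \<alpha> (Y_tilde N)"
    "\<not> congruent_sets Y (Y_tilde N) \<Longrightarrow> \<alpha> \<noteq> 0 \<Longrightarrow> lambda1 \<alpha> Y < lambda1 \<alpha> (Y_tilde N)"
    if a: "\<bar>\<alpha>\<bar> < \<alpha>\<^sub>0" for \<alpha>
  proof -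
    obtain \<kappa> where k: "\<bar>\<kappa>\<bar> \<le> 1/16" and \<alpha>: "\<alpha> = 2 * gtan \<kappa> ?l" using tilde[OF a] by blast
    have t: "lambda1 \<alpha> (Y_tilde N) = \<kappa>" unfolding \<alpha> by (rule lambda1_Y_tilde[OF N k])
    obtain v where v: "v (Suc N) = v 0" "\<exists>i\<le>N. v i \<noteq> 0"
      and Qv: "Q \<alpha> \<kappa> v = \<alpha> * N - 2 * (\<Sum>j\<in>{1..N}. gtan \<kappa> (gap j))"
      using test_vector[OF N k] by metis
    \<comment> \<open>With this \<alpha> the value of \<open>Q\<close> is twice the Jensen defect, N
      gtan \<kappa> ?l minus the sum over the gaps.\<close>
    have Q0: "Q \<alpha> \<kappa> v \<le> 0"
      unfolding Qv using sum_gtan_gap(1)[OF N k] by (simp add: \<alpha> algebra_simps)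
    note var = lambda1_variational[OF small[OF a] k v Q0, unfolded Y]
    show "lambda1 \<alpha> Y \<le> lambda1 \<alpha> (Y_tilde N)" using var(1) t by simp
    assume nc: "\<not> congruent_sets Y (Y_tilde N)" and "\<alpha> \<noteq> 0"
    then have "\<kappa> \<noteq> 0" by (auto simp: \<alpha> gtan_def)
    moreover obtain j where "j \<in> {1..N}" "gap j \<noteq> ?l"
      using congruent_of_equal_gaps[OF N] nc Y by blast
    ultimately have "Q \<alpha> \<kappa> v < 0"
      unfolding Qv using sum_gtan_gap(2)[OF N k] by (simp add: \<alpha> algebra_simps)
    then show "lambda1 \<alpha> Y < lambda1 \<alpha> (Y_tilde N)" using var(2) t by simp
  qed
  show ?thesis using pos main by (intro exI[of _ \<alpha>\<^sub>0]) auto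
qed

end
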